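(* Let $G \in \mathcal{C}$. Then $G$ is a $4$-$\chi_\rho$-critical graph if and only if $G$ is one of the following graphs: (1) $G \cong C_n$ with $n \geq 5$ and $n \not\equiv 0 \pmod 4$; (2) $G$ is the net graph; (3) $G$ is obtained by attaching a single leaf to each of two adjacent vertices of $C_4$.
   Context: Graphs are finite and simple. $\mathcal{C}$ is the class of graphs that contain exactly one cycle and are obtained from a cycle by attaching an arbitrary number (possibly zero) of leaves (pendant vertices of degree 1) to each vertex of the cycle. The net graph is obtained by attaching a single leaf to each vertex of $C_3$. A $k$-packing coloring of $G$ is a map $c:V(G)\to\{1,\ldots,k\}$ such that two distinct vertices $u,v$ with $c(u)=c(v)=i$ satisfy $d_G(u,v)>i$ (distance between vertices in different components is infinite); $\chi_\rho(G)$ is the smallest $k$ for which such a coloring exists. $G$ is $4$-$\chi_\rho$-critical if $\chi_\rho(G)=4$ and $\chi_\rho(H)<\chi_\rho(G)$ for every proper subgraph $H$ of $G$. *)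

theory Defs
  imports Main "HOL-Library.Extended_Nat"
begin

type_synonym 'a graph = "'a set \<times> 'a set set"

definition verts :: "'a graph \<Rightarrow> 'a set" where "verts G = fst G"
definition edges :: "'a graph \<Rightarrow> 'a set set" where "edges G = snd G"

definition wf_graph :: "'a graph \<Rightarrow> bool" where
  "wf_graph G \<longleftrightarrow> finite (verts G) \<and>
     (\<forall>e\<in>edges G. \<exists>u v. e = {u, v} \<and> u \<noteq> v \<and> u \<in> verts G \<and> v \<in> verts G)"

definition adj :: "'a graph \<Rightarrow> 'a \<Rightarrow> 'a \<Rightarrow> bool" where
  "adj G u v \<longleftrightarrow> {u, v} \<in> edges G"

definition is_walk :: "'a graph \<Rightarrow> 'a list \<Rightarrow> bool" where
  "is_walk G xs \<longleftrightarrow> xs \<noteq> [] \<and> set xs \<subseteq> verts G \<and>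
     (\<forall>i. Suc i < length xs \<longrightarrow> adj G (xs ! i) (xs ! Suc i))"

text \<open>Distance in G (infinity if no walk, i.e. different components).\<close>
definition dist :: "'a graph \<Rightarrow> 'a \<Rightarrow> 'a \<Rightarrow> enat" where
  "dist G u v = Inf {enat (length xs - 1) | xs. is_walk G xs \<and> hd xs = u \<and> last xs = v}"

definition packing_coloring :: "'a graph \<Rightarrow> nat \<Rightarrow> ('a \<Rightarrow> nat) \<Rightarrow> bool" where
  "packing_coloring G k c \<longleftrightarrow>
     (\<forall>v\<in>verts G. c v \<in> {1..k}) \<and>
     (\<forall>u\<in>verts G. \<forall>v\<in>verts G. u \<noteq> v \<and> c u = c v \<longrightarrow> dist G u v > enat (c u))"

definition packing_chromatic :: "'a graph \<Rightarrow> nat" where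
  "packing_chromatic G = (LEAST k. \<exists>c. packing_coloring G k c)"

definition proper_subgraph :: "'a graph \<Rightarrow> 'a graph \<Rightarrow> bool" where
  "proper_subgraph H G \<longleftrightarrow> wf_graph H \<and> verts H \<subseteq> verts G \<and> edges H \<subseteq> edges G \<and> H \<noteq> G"

definition critical4 :: "'a graph \<Rightarrow> bool" where
  "critical4 G \<longleftrightarrow> packing_chromatic G = 4 \<and>
     (\<forall>H. proper_subgraph H G \<longrightarrow> packing_chromatic H < packing_chromatic G)"

definition graph_iso :: "'a graph \<Rightarrow> 'b graph \<Rightarrow> bool" where
  "graph_iso G H \<longleftrightarrow> (\<exists>f. bij_betw f (verts G) (verts H) \<and>
     (\<forall>u\<in>verts G. \<forall>v\<in>verts G. {u, v} \<in> edges G \<longleftrightarrow> {f u, f v} \<in> edges H))"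

definition cycle_edges :: "'a list \<Rightarrow> 'a set set" where
  "cycle_edges cs = {{cs ! i, cs ! ((i + 1) mod length cs)} | i. i < length cs}"

definition classC :: "'a graph set" where
  "classC = {G. \<exists>cs L att.
      distinct cs \<and> length cs \<ge> 3 \<and> finite L \<and> L \<inter> set cs = {} \<and>
      (\<forall>l\<in>L. att l \<in> set cs) \<and>
      verts G = set cs \<union> L \<and>
      edges G = cycle_edges cs \<union> {{l, att l} | l. l \<in> L}}"

definition cycle_graph :: "nat \<Rightarrow> nat graph" where
  "cycle_graph n = ({0..<n}, cycle_edges [0..<n])"

definition net_graph :: "nat graph" where
  "net_graph = ({0..<6}, cycle_edges [0,1,2] \<union> {{0,3},{1,4},{2,5}})"

definition C4_two_leaves :: "nat graph" where
  "C4_two_leaves = ({0..<6}, cycle_edges [0,1,2,3] \<union> {{0,4},{1,5}})"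

end

theory Submission
  imports Defs
begin

text \<open>
  In a packing colouring with colours 1, 2, 3 a vertex of degree at least 3 cannot have colour 1, and
  an edge which is prolonged by at least two vertices on both sides has an end of colour 1. Hence
  around a cycle of length at least 4 colour 1 alternates with the colours 2 and 3, and the latter
  alternate among themselves: a long cycle has such a colouring only if 4 divides its length, and
  then two leaves attached at odd distance are an obstruction. For length at least 8 this obstruction
  survives the deletion of a cycle edge far from both leaves, so the graph is not critical; for
  length 4 it is the third graph of the list. In a triangle with a leaf at each vertex all three
  cycle vertices would need colours from \<open>{2, 3}\<close>. All remaining graphs are coloured by the pattern
  1213, or by giving colour 1 to the complement of a vertex cover.
\<close>

text \<open>Non-colourability needs only walks of at most three edges, because 3 is the largest
  colour. Colourability needs lower bounds on distances; these come from integer positions that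
  change by at most 1 along each edge, on a line or modulo the length of the cycle. Necessity rests
  on one principle: a subgraph of a critical graph without a 3-colouring is the whole graph. So it
  is enough to locate an obstruction inside \<open>G\<close>; its own criticality matters only for
  the converse. The bound 8 is a matter of room. If the leaves sit \<open>k\<close> apart,
  alternation along the arc needs two intact edges beyond either end, and one more edge is deleted,
  which takes \<open>k + 5\<close> edges of the cycle. For the shorter arc
  \<open>2 * k \<le> n\<close>, and with \<open>k\<close> odd and \<open>4 dvd n\<close> there is
  room once \<open>n \<ge> 8\<close>. At length 4 there is none, but \<open>k = 1\<close> is forced
  there, so the graph is known. A triangle is too short for the alternation argument and is treated
  through vertex covers.\<close>

definition packing_colorable :: "'a graph \<Rightarrow> nat \<Rightarrow> bool" where
  "packing_colorable G k \<longleftrightarrow> (\<exists>c. packing_coloring G k c)"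

definition map_graph :: "('a \<Rightarrow> 'b) \<Rightarrow> 'a graph \<Rightarrow> 'b graph" where
  "map_graph g G = (g ` verts G, (`) g ` edges G)"

lemma verts_Pair [simp]: "verts (V, E) = V"
  and edges_Pair [simp]: "edges (V, E) = E"
  by (simp_all add: verts_def edges_def)

lemma graph_eqI: "verts G = verts H \<Longrightarrow> edges G = edges H \<Longrightarrow> G = H"
  by (simp add: verts_def edges_def prod_eq_iff)

lemma adj_commute: "adj G u v \<longleftrightarrow> adj G v u"
  by (simp add: adj_def insert_commute)

lemma adj_wfD:
  assumes "wf_graph G" "adj G u v"
  shows "u \<in> verts G" "v \<in> verts G" "u \<noteq> v"
  using assms unfolding wf_graph_def adj_def by (auto simp: doubleton_eq_iff)

lemma wf_graph_iff_card:
  "wf_graph G \<longleftrightarrow> finite (verts G) \<and> (\<forall>e\<in>edges G. e \<subseteq> verts G \<and> card e = 2)"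
proof -
  have "(\<exists>u v. e = {u, v} \<and> u \<noteq> v \<and> u \<in> verts G \<and> v \<in> verts G) \<longleftrightarrow> e \<subseteq> verts G \<and> card e = 2" for e
    by (auto simp: card_2_iff)
  then show ?thesis by (simp add: wf_graph_def)
qed

section \<open>Distances expressed through walks\<close>

text \<open>The infimum is traded for a condition on all walks; for vertices in different components
  the condition is vacuous, matching the value infinity.\<close>

lemma enat_less_dist_iff:
  "enat k < dist G u v \<longleftrightarrow>
     (\<forall>xs. is_walk G xs \<and> hd xs = u \<and> last xs = v \<longrightarrow> k < length xs - 1)"
proof -
  have "enat k < dist G u v \<longleftrightarrow> enat (Suc k) \<le> dist G u v"
    by (simp add: Suc_ile_eq)
  then show ?thesis
    by (auto simp: dist_def le_Inf_iff Suc_le_eq)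
qed

lemma packing_coloring_walk:
  assumes "packing_coloring G k c" "is_walk G xs" "hd xs \<noteq> last xs" "c (hd xs) = c (last xs)"
  shows "c (hd xs) < length xs - 1"
proof -
  have "hd xs \<in> verts G" "last xs \<in> verts G"
    using assms(2) by (auto simp: is_walk_def)
  then have "enat (c (hd xs)) < dist G (hd xs) (last xs)"
    using assms by (auto simp: packing_coloring_def)
  then show ?thesis
    using assms(2) by (auto simp: enat_less_dist_iff)
qed

lemma is_walk_Cons:
  "is_walk G (x # y # xs) \<longleftrightarrow> x \<in> verts G \<and> adj G x y \<and> is_walk G (y # xs)"
  by (auto simp: is_walk_def nth_Cons split: nat.splits)

lemma is_walk_single: "is_walk G [x] \<longleftrightarrow> x \<in> verts G"
  by (auto simp: is_walk_def)

text \<open>Walks with 1, 2 and 3 edges used as upper bounds for the distance. Walks may repeat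
  vertices, so only the two ends have to be distinct.\<close>

lemma packing_coloring_path:
  assumes wf: "wf_graph G" and c: "packing_coloring G k c"
  shows packing_coloring_adj: "adj G u v \<Longrightarrow> c u \<noteq> c v"
    and packing_coloring_path2: "adj G u w \<Longrightarrow> adj G w v \<Longrightarrow> u \<noteq> v \<Longrightarrow> c u = c v \<Longrightarrow> c u = 1"
    and packing_coloring_path3:
      "adj G u w \<Longrightarrow> adj G w x \<Longrightarrow> adj G x v \<Longrightarrow> u \<noteq> v \<Longrightarrow> c u = c v \<Longrightarrow> c u < 3"
proof -
  have pos: "c v \<ge> 1" if "v \<in> verts G" for v
    using c that by (auto simp: packing_coloring_def)
  show "c u \<noteq> c v" if "adj G u v"
    using packing_coloring_walk[OF c, of "[u, v]"] adj_wfD[OF wf that] that pos[of u]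
    by (auto simp: is_walk_Cons is_walk_single)
  show "c u = 1" if "adj G u w" "adj G w v" "u \<noteq> v" "c u = c v"
    using packing_coloring_walk[OF c, of "[u, w, v]"] adj_wfD[OF wf that(1)] adj_wfD[OF wf that(2)]
      that pos[of u]
    by (auto simp: is_walk_Cons is_walk_single)
  show "c u < 3" if "adj G u w" "adj G w x" "adj G x v" "u \<noteq> v" "c u = c v"
    using packing_coloring_walk[OF c, of "[u, w, x, v]"] adj_wfD[OF wf that(1)]
      adj_wfD[OF wf that(2)] adj_wfD[OF wf that(3)] that
    by (auto simp: is_walk_Cons is_walk_single)
qed

section \<open>Colours forced by a 3-colouring\<close>

lemma packing_coloring_3_cases:
  assumes "packing_coloring G 3 c" "v \<in> verts G"
  obtains "c v = 1" | "c v = 2" | "c v = 3"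
proof -
  have "c v \<in> {1..3}"
    using assms by (simp add: packing_coloring_def)
  then have "c v = 1 \<or> c v = 2 \<or> c v = 3" by auto
  then show thesis using that by blast
qed

text \<open>Pigeonhole: three neighbours of a vertex of colour 1 would share the colours 2 and 3,
  but they are pairwise at distance at most 2.\<close>

lemma branch_vertex_not_1:
  assumes wf: "wf_graph G" and c: "packing_coloring G 3 c"
    and a: "adj G v x" "adj G v y" "adj G v z" and d: "x \<noteq> y" "x \<noteq> z" "y \<noteq> z"
  shows "c v \<noteq> 1"
proof
  assume 1: "c v = 1"
  have n: "c t = 2 \<or> c t = 3" if "adj G v t" for t
    using packing_coloring_3_cases[OF c adj_wfD(2)[OF wf that]] packing_coloring_adj[OF wf c that] 1
    by metis
  have "c s \<noteq> c t" if "adj G v s" "adj G v t" "s \<noteq> t" for s t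
    using packing_coloring_path2[OF wf c, of s v t] n[of s] that by (auto simp: adj_commute)
  then show False using n a d by metis
qed

text \<open>In a path \<open>y x u v\<close>, if \<open>u, v\<close> have colours 2, 3, then \<open>x\<close> is forced to have colour 1 and
  no colour is left for \<open>y\<close>.\<close>
lemma no_adjacent_2_3:
  assumes wf: "wf_graph G" and c: "packing_coloring G 3 c"
    and a: "adj G y x" "adj G x u" "adj G u v" and d: "y \<noteq> u" "y \<noteq> v" "x \<noteq> v"
  shows "\<not> (c u = 2 \<and> c v = 3)"
proof
  assume uv: "c u = 2 \<and> c v = 3"
  have "c x \<noteq> 2" using packing_coloring_adj[OF wf c a(2)] uv by simp
  moreover have "c x \<noteq> 3" using packing_coloring_path2[OF wf c a(2,3) d(3)] uv by auto
  ultimately have "c x = 1"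
    using packing_coloring_3_cases[OF c adj_wfD(1)[OF wf a(2)]] by metis
  then have "c y \<noteq> 1" using packing_coloring_adj[OF wf c a(1)] by simp
  moreover have "c y \<noteq> 2" using packing_coloring_path2[OF wf c a(1,2) d(1)] uv by auto
  moreover have "c y \<noteq> 3" using packing_coloring_path3[OF wf c a d(2)] uv by auto
  ultimately show False
    using packing_coloring_3_cases[OF c adj_wfD(1)[OF wf a(1)]] by metis
qed

text \<open>Two applications of the previous lemma, one from each side of the edge. Nothing keeps
  \<open>x\<close>, \<open>y\<close> apart from \<open>w\<close>, \<open>z\<close>, so the two
  prolongations may overlap; this is what makes the lemma usable on a 4-cycle.\<close>

lemma inner_edge_alternates:
  assumes wf: "wf_graph G" and c: "packing_coloring G 3 c"
    and a: "adj G y x" "adj G x u" "adj G u v" "adj G v w" "adj G w z"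
    and d: "y \<noteq> u" "y \<noteq> v" "x \<noteq> v" "u \<noteq> w" "u \<noteq> z" "v \<noteq> z"
  shows "c u = 1 \<longleftrightarrow> c v \<noteq> 1"
proof -
  have "\<not> (c u = 2 \<and> c v = 3)"
    using no_adjacent_2_3[OF wf c a(1-3) d(1-3)] .
  moreover have "\<not> (c v = 2 \<and> c u = 3)"
    using no_adjacent_2_3[OF wf c, of z w v u] a d by (auto simp: adj_commute)
  moreover have "c u \<noteq> c v" using packing_coloring_adj[OF wf c a(3)] .
  moreover have "c u = 1 \<or> c u = 2 \<or> c u = 3" "c v = 1 \<or> c v = 2 \<or> c v = 3"
    using packing_coloring_3_cases[OF c] adj_wfD(1,2)[OF wf a(3)] by metis+
  ultimately show ?thesis by auto
qed

text \<open>With \<open>N = 0\<close> the hypothesis says that \<open>f\<close> is 1-Lipschitz; positive \<open>N\<close> is for positions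
  around a cycle of length \<open>N\<close>.\<close>
lemma walk_displacement:
  fixes f :: "'a \<Rightarrow> int"
  assumes "is_walk G xs"
    and lip: "\<And>u v. adj G u v \<Longrightarrow> \<exists>d. \<bar>d\<bar> \<le> 1 \<and> N dvd (f v - f u - d)"
  shows "\<exists>d. \<bar>d\<bar> \<le> int (length xs - 1) \<and> N dvd (f (last xs) - f (hd xs) - d)"
  using assms(1)
proof (induction xs rule: induct_list012)
  case (3 x y xs)
  then obtain d where d: "\<bar>d\<bar> \<le> int (length xs)" "N dvd (f (last (y # xs)) - f y - d)"
    by (auto simp: is_walk_Cons)
  obtain e where e: "\<bar>e\<bar> \<le> 1" "N dvd (f y - f x - e)"
    using lip 3(3) by (auto simp: is_walk_Cons)
  have "N dvd (f (last (y # xs)) - f y - d) + (f y - f x - e)"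
    using d(2) e(2) by (rule dvd_add)
  then have "N dvd (f (last (y # xs)) - f x - (d + e))"
    by (simp add: algebra_simps)
  then show ?case
    using d(1) e(1) by (intro exI[of _ "d + e"]) auto
qed (auto simp: is_walk_def)

section \<open>Constructing colourings\<close>

text \<open>A walk between \<open>u\<close> and \<open>v\<close> realises some displacement
  \<open>d\<close> with at least \<open>\<bar>d\<bar>\<close> edges, so large displacements certify
  large distances. For colour 1 nonadjacency is enough, and that alternative also serves vertices
  that share a position.\<close>

lemma packing_coloringI_displacement:
  fixes f :: "'a \<Rightarrow> int"
  assumes range: "\<And>v. v \<in> verts G \<Longrightarrow> c v \<in> {1..k}"
    and lip: "\<And>u v. adj G u v \<Longrightarrow> \<exists>d. \<bar>d\<bar> \<le> 1 \<and> N dvd (f v - f u - d)"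
    and sep: "\<And>u v. u \<in> verts G \<Longrightarrow> v \<in> verts G \<Longrightarrow> u \<noteq> v \<Longrightarrow> c u = c v \<Longrightarrow>
      c u = 1 \<and> \<not> adj G u v \<or> (\<forall>d. N dvd (f v - f u - d) \<longrightarrow> \<bar>d\<bar> > int (c u))"
  shows "packing_coloring G k c"
  unfolding packing_coloring_def enat_less_dist_iff
proof (intro conjI ballI impI allI)
  fix u v xs
  assume uv: "u \<in> verts G" "v \<in> verts G" "u \<noteq> v \<and> c u = c v"
    and xs: "is_walk G xs \<and> hd xs = u \<and> last xs = v"
  from sep[OF uv(1,2)] uv(3) consider "c u = 1" "\<not> adj G u v"
    | "\<forall>d. N dvd (f v - f u - d) \<longrightarrow> \<bar>d\<bar> > int (c u)"
    by blast
  then show "c u < length xs - 1"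
  proof cases
    case 1
    have "xs \<noteq> []" using xs by (simp add: is_walk_def)
    moreover have "xs \<noteq> [x]" for x using xs uv(3) by auto
    moreover have "xs \<noteq> [x, y]" for x y using xs 1(2) by (auto simp: is_walk_Cons)
    ultimately have "2 < length xs"
      by (metis length_0_conv length_Suc_conv linorder_neqE_nat less_2_cases numeral_2_eq_2)
    then show ?thesis using 1(1) by simp
  next
    case 2
    obtain d where "\<bar>d\<bar> \<le> int (length xs - 1)" "N dvd (f v - f u - d)"
      using walk_displacement[where f = f and N = N, OF conjunct1[OF xs] lip] xs by auto
    then show ?thesis using 2 by fastforce
  qed
qed (use range in auto)

text \<open>Vertices outside a cover are pairwise nonadjacent, which is all that colour 1 asks for;
  each cover vertex receives a colour of its own from 2 upwards.\<close>

lemma vertex_cover_packing_colorable: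
  assumes S: "finite S" and cover: "\<And>e. e \<in> edges G \<Longrightarrow> e \<inter> S \<noteq> {}"
  shows "packing_colorable G (Suc (card S))"
proof -
  obtain h where h: "bij_betw h S {0..<card S}"
    using ex_bij_betw_finite_nat[OF S] by blast
  have h_less: "v \<in> S \<Longrightarrow> h v < card S" for v
    using h by (auto simp: bij_betw_def)
  have h_inj: "u = v" if "u \<in> S" "v \<in> S" "h u = h v" for u v
    using h that by (auto simp: bij_betw_def inj_on_def)
  have "packing_coloring G (Suc (card S)) (\<lambda>v. if v \<in> S then h v + 2 else 1)"
  \<comment> \<open>A constant \<open>f\<close> makes the edge condition trivial and certifies no
    distance; only the nonadjacency alternative is used.\<close>
  proof (rule packing_coloringI_displacement[where f = "\<lambda>_. 0" and N = 1])
    fix v show "(if v \<in> S then h v + 2 else 1) \<in> {1..Suc (card S)}"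
      using h_less[of v] by auto
  next
    fix u v
    assume "u \<noteq> v" "(if u \<in> S then h u + 2 else 1) = (if v \<in> S then h v + 2 else 1)"
    then have "u \<notin> S" "v \<notin> S"
      using h_inj by (auto split: if_splits)
    moreover from this have "\<not> adj G u v"
      using cover by (auto simp: adj_def)
    ultimately show "(if u \<in> S then h u + 2 else 1) = 1 \<and> \<not> adj G u v \<or>
       (\<forall>d. 1 dvd ((0::int) - 0 - d) \<longrightarrow> \<bar>d\<bar> > int (if u \<in> S then h u + 2 else 1))"
      by auto
  qed (auto intro: exI[of _ 0])
  then show ?thesis by (auto simp: packing_colorable_def)
qed

lemma wf_graph_edge_subset: "wf_graph G \<Longrightarrow> e \<in> edges G \<Longrightarrow> e \<noteq> {} \<and> e \<subseteq> verts G"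
  unfolding wf_graph_def by auto

text \<open>Ensures that the \<open>LEAST\<close> in \<open>packing_chromatic\<close> is attained;
  the cover is the whole vertex set.\<close>

lemma packing_colorable_card:
  assumes "wf_graph G"
  shows "packing_colorable G (Suc (card (verts G)))"
  using assms wf_graph_edge_subset[OF assms]
  by (intro vertex_cover_packing_colorable) (auto simp: wf_graph_def)

lemma packing_colorable_mono:
  assumes "packing_colorable G k" "k \<le> m"
  shows "packing_colorable G m"
  using assms unfolding packing_colorable_def packing_coloring_def by fastforce

lemma packing_colorable_subgraph:
  assumes "packing_colorable G k" "verts H \<subseteq> verts G" "edges H \<subseteq> edges G"
  shows "packing_colorable H k"
proof -
  obtain c where c: "packing_coloring G k c"
    using assms(1) by (auto simp: packing_colorable_def)
  have "is_walk H xs \<Longrightarrow> is_walk G xs" for xs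
    using assms(2,3) by (auto simp: is_walk_def adj_def)
  then have "packing_coloring H k c"
    using c assms(2) unfolding packing_coloring_def enat_less_dist_iff by blast
  then show ?thesis by (auto simp: packing_colorable_def)
qed

section \<open>Criticality in terms of 3-colourability\<close>

lemma packing_chromatic_less_iff:
  assumes "wf_graph G"
  shows "packing_chromatic G < Suc k \<longleftrightarrow> packing_colorable G k"
proof
  assume less: "packing_chromatic G < Suc k"
  have "packing_colorable G (packing_chromatic G)"
    unfolding packing_chromatic_def packing_colorable_def
    by (rule LeastI_ex) (use packing_colorable_card[OF assms] in \<open>auto simp: packing_colorable_def\<close>)
  then show "packing_colorable G k"
    by (rule packing_colorable_mono) (use less in simp)
next
  assume "packing_colorable G k"
  then show "packing_chromatic G < Suc k"
    unfolding packing_chromatic_def packing_colorable_def by (simp add: Least_le less_Suc_eq_le)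
qed

lemma critical4D:
  assumes "critical4 G" "wf_graph G"
  shows "\<not> packing_colorable G 3"
    and "proper_subgraph H G \<Longrightarrow> packing_colorable H 3"
proof -
  have G: "packing_chromatic G = 4"
    using assms(1) by (simp add: critical4_def)
  then show "\<not> packing_colorable G 3"
    using packing_chromatic_less_iff[OF assms(2), of 3] by simp
  assume H: "proper_subgraph H G"
  then have "packing_chromatic H < 4" "wf_graph H"
    using assms(1) G unfolding critical4_def proper_subgraph_def by metis+
  then show "packing_colorable H 3"
    using packing_chromatic_less_iff[of H 3] by simp
qed

text \<open>Without isolated vertices a subgraph with all edges also has all vertices. Hence every
  proper subgraph misses an edge and lies inside a graph obtained by deleting a single edge.\<close>

lemma critical4I:
  assumes wf: "wf_graph G" and n3: "\<not> packing_colorable G 3" and c4: "packing_colorable G 4"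
    and iso: "\<And>v. v \<in> verts G \<Longrightarrow> \<exists>e\<in>edges G. v \<in> e"
    and del: "\<And>e. e \<in> edges G \<Longrightarrow> packing_colorable (verts G, edges G - {e}) 3"
  shows "critical4 G"
  unfolding critical4_def
proof (intro conjI allI impI)
  show 4: "packing_chromatic G = 4"
    using packing_chromatic_less_iff[OF wf, of 3] packing_chromatic_less_iff[OF wf, of 4] n3 c4
    by auto
  fix H assume H: "proper_subgraph H G"
  then have wfH: "wf_graph H" and sub: "verts H \<subseteq> verts G" "edges H \<subseteq> edges G" and ne: "H \<noteq> G"
    by (auto simp: proper_subgraph_def)
  have "edges H \<noteq> edges G"
  proof
    assume eq: "edges H = edges G"
    then have "verts G \<subseteq> verts H"
      using iso wf_graph_edge_subset[OF wfH] by blast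
    then show False using eq ne sub graph_eqI[of H G] by auto
  qed
  then obtain e where "e \<in> edges G" "e \<notin> edges H" using sub by auto
  then have "packing_colorable H 3"
    using sub by (intro packing_colorable_subgraph[OF del[of e]]) auto
  then show "packing_chromatic H < packing_chromatic G"
    using packing_chromatic_less_iff[OF wfH, of 3] 4 by simp
qed

section \<open>Isomorphism as relabelling\<close>

text \<open>Replaces isomorphism by equality with a relabelled copy, the form in which a copy found
  inside \<open>G\<close> can be compared with \<open>G\<close> itself.\<close>

lemma graph_iso_iff_map_graph:
  assumes wfG: "wf_graph G" and wfH: "wf_graph H"
  shows "graph_iso G H \<longleftrightarrow> (\<exists>g. inj_on g (verts H) \<and> G = map_graph g H)"
proof
  assume "graph_iso G H"
  then obtain f where f: "bij_betw f (verts G) (verts H)"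
    and e: "\<And>u v. u \<in> verts G \<Longrightarrow> v \<in> verts G \<Longrightarrow> {u, v} \<in> edges G \<longleftrightarrow> {f u, f v} \<in> edges H"
    by (auto simp: graph_iso_def)
  define g where "g = inv_into (verts G) f"
  have g: "bij_betw g (verts H) (verts G)"
    unfolding g_def by (rule bij_betw_inv_into[OF f])
  have fg: "f (g x) = x" if "x \<in> verts H" for x
    using bij_betw_inv_into_right[OF f that] by (simp add: g_def)
  have gf: "g (f x) = x" if "x \<in> verts G" for x
    using bij_betw_inv_into_left[OF f that] by (simp add: g_def)
  have f_in: "x \<in> verts G \<Longrightarrow> f x \<in> verts H" for x
    using f by (auto simp: bij_betw_def)
  have g_in: "x \<in> verts H \<Longrightarrow> g x \<in> verts G" for x
    using g by (auto simp: bij_betw_def)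
  have "edges G = (`) g ` edges H"
  proof (intro equalityI subsetI)
    fix d assume d: "d \<in> edges G"
    then obtain u v where uv: "d = {u, v}" "u \<in> verts G" "v \<in> verts G"
      using wfG by (auto simp: wf_graph_def)
    then have "{f u, f v} \<in> edges H" "d = g ` {f u, f v}"
      using e d gf by auto
    then show "d \<in> (`) g ` edges H" by blast
  next
    fix d assume "d \<in> (`) g ` edges H"
    then obtain d' where d': "d' \<in> edges H" "d = g ` d'" by auto
    then obtain u v where "d' = {u, v}" "u \<in> verts H" "v \<in> verts H"
      using wfH unfolding wf_graph_def by blast
    then show "d \<in> edges G"
      using d' e[of "g u" "g v"] fg g_in by auto
  qed
  then show "\<exists>g. inj_on g (verts H) \<and> G = map_graph g H"
    using g by (intro exI[of _ g] conjI graph_eqI) (auto simp: map_graph_def bij_betw_def)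
next
  assume "\<exists>g. inj_on g (verts H) \<and> G = map_graph g H"
  then obtain g where inj: "inj_on g (verts H)" and G: "G = map_graph g H" by blast
  define f where "f = inv_into (verts H) g"
  have g: "bij_betw g (verts H) (verts G)"
    using inj by (auto simp: bij_betw_def G map_graph_def)
  have f: "bij_betw f (verts G) (verts H)"
    unfolding f_def by (rule bij_betw_inv_into[OF g])
  have fg: "f (g x) = x" if "x \<in> verts H" for x
    using bij_betw_inv_into_left[OF g that] by (simp add: f_def)
  have "{g x, g y} \<in> edges G \<longleftrightarrow> {x, y} \<in> edges H" if xy: "x \<in> verts H" "y \<in> verts H" for x y
  proof
    assume "{g x, g y} \<in> edges G"
    then obtain d where d: "d \<in> edges H" "g ` {x, y} = g ` d"
      by (auto simp: G map_graph_def)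
    then have "{x, y} = d"
      using inj_on_image_eq_iff[OF inj, of "{x, y}" d] xy wf_graph_edge_subset[OF wfH d(1)] by simp
    then show "{x, y} \<in> edges H" using d by simp
  next
    assume "{x, y} \<in> edges H"
    then have "g ` {x, y} \<in> (`) g ` edges H" by (rule imageI)
    then show "{g x, g y} \<in> edges G" by (simp add: G map_graph_def)
  qed
  moreover have "verts G = g ` verts H" by (simp add: G map_graph_def)
  ultimately show "graph_iso G H"
    unfolding graph_iso_def using f fg by (intro exI[of _ f]) auto
qed

subsection \<open>The two exceptional graphs\<close>

text \<open>For \<open>N = 0\<close> divisibility is equality, so positions lie on a line. The
  bounded quantifiers let simplification decide the hypotheses on explicit finite graphs.\<close>

lemma packing_coloringI_lipschitz:
  fixes f :: "'a \<Rightarrow> int"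
  assumes "\<forall>v\<in>verts G. 1 \<le> c v \<and> c v \<le> k"
    and "\<forall>e\<in>edges G. \<forall>u\<in>e. \<forall>v\<in>e. \<bar>f u - f v\<bar> \<le> 1"
    and "\<forall>u\<in>verts G. \<forall>v\<in>verts G. c u = c v \<longrightarrow>
      u = v \<or> c u = 1 \<and> {u, v} \<notin> edges G \<or> \<bar>f u - f v\<bar> > int (c u)"
  shows "packing_coloring G k c"
proof (rule packing_coloringI_displacement[where f = f and N = 0])
  show "\<exists>d. \<bar>d\<bar> \<le> 1 \<and> 0 dvd (f v - f u - d)" if "adj G u v" for u v
    using assms(2) that by (intro exI[of _ "f v - f u"]) (auto simp: adj_def)
  show "c u = 1 \<and> \<not> adj G u v \<or> (\<forall>d. 0 dvd (f v - f u - d) \<longrightarrow> \<bar>d\<bar> > int (c u))"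
    if "u \<in> verts G" "v \<in> verts G" "u \<noteq> v" "c u = c v" for u v
    using assms(3) that by (auto simp: adj_def abs_minus_commute)
qed (use assms(1) in auto)

text \<open>The path \<open>x a m u y\<close> with an extra leaf \<open>z\<close> at
  \<open>m\<close>, coloured 3 1 2 1 3 along the path and 1 on \<open>z\<close>; the two vertices of
  colour 3 are four apart. It remains of the net without a triangle edge, and of the third graph
  without a cycle edge next to the one joining the branch vertices.\<close>

lemma spider_packing_colorable:
  assumes d: "distinct [x, a, m, u, y, z]"
  shows "packing_colorable ({x, a, m, u, y, z}, {{x, a}, {a, m}, {m, u}, {u, y}, {m, z}}) 3"
proof -
  \<comment> \<open>Supplies each inequality in the opposite orientation for the simplifier.\<close>
  have d': "distinct (rev [x, a, m, u, y, z])"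
    unfolding distinct_rev by (rule d)
  define f where "f = ((\<lambda>_. 0 :: int)(x := 0, a := 1, m := 2, u := 3, y := 4, z := 2))"
  define h where "h = ((\<lambda>_. 0 :: nat)(x := 3, a := 1, m := 2, u := 1, y := 3, z := 1))"
  have f: "f x = 0" "f a = 1" "f m = 2" "f u = 3" "f y = 4" "f z = 2"
    using d by (auto simp: f_def)
  have h: "h x = 3" "h a = 1" "h m = 2" "h u = 1" "h y = 3" "h z = 1"
    using d by (auto simp: h_def)
  have "packing_coloring ({x, a, m, u, y, z}, {{x, a}, {a, m}, {m, u}, {u, y}, {m, z}}) 3 h"
    by (rule packing_coloringI_lipschitz[where f = f])
      (use d d' in \<open>simp_all add: f h doubleton_eq_iff\<close>)
  then show ?thesis by (auto simp: packing_colorable_def)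
qed

text \<open>What remains of the third graph when the edge between its two branch vertices is
  deleted; colours 1 2 1 3 1 2, with the two vertices of colour 2 four apart.\<close>

lemma path6_packing_colorable:
  assumes d: "distinct [x, a, u, v, w, y]"
  shows "packing_colorable ({x, a, u, v, w, y}, {{x, a}, {a, u}, {u, v}, {v, w}, {w, y}}) 3"
proof -
  have d': "distinct (rev [x, a, u, v, w, y])"
    unfolding distinct_rev by (rule d)
  define f where "f = ((\<lambda>_. 0 :: int)(x := 0, a := 1, u := 2, v := 3, w := 4, y := 5))"
  define h where "h = ((\<lambda>_. 0 :: nat)(x := 1, a := 2, u := 1, v := 3, w := 1, y := 2))"
  have f: "f x = 0" "f a = 1" "f u = 2" "f v = 3" "f w = 4" "f y = 5"
    using d by (auto simp: f_def)
  have h: "h x = 1" "h a = 2" "h u = 1" "h v = 3" "h w = 1" "h y = 2"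
    using d by (auto simp: h_def)
  have "packing_coloring ({x, a, u, v, w, y}, {{x, a}, {a, u}, {u, v}, {v, w}, {w, y}}) 3 h"
    by (rule packing_coloringI_lipschitz[where f = f])
      (use d d' in \<open>simp_all add: f h doubleton_eq_iff\<close>)
  then show ?thesis by (auto simp: packing_colorable_def)
qed

lemma vertex_cover2_packing_colorable:
  assumes "\<And>e. e \<in> edges G \<Longrightarrow> a \<in> e \<or> b \<in> e"
  shows "packing_colorable G 3"
proof -
  have "packing_colorable G (Suc (card {a, b}))"
    using assms by (intro vertex_cover_packing_colorable) auto
  moreover have "Suc (card {a, b}) \<le> 3"
    by (simp add: card_insert_if)
  ultimately show ?thesis by (rule packing_colorable_mono)
qed

lemma vertex_cover3_packing_colorable:
  assumes "\<And>e. e \<in> edges G \<Longrightarrow> a \<in> e \<or> b \<in> e \<or> c \<in> e"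
  shows "packing_colorable G 4"
proof -
  have "packing_colorable G (Suc (card {a, b, c}))"
    using assms by (intro vertex_cover_packing_colorable) auto
  moreover have "Suc (card {a, b, c}) \<le> 4"
    by (simp add: card_insert_if)
  ultimately show ?thesis by (rule packing_colorable_mono)
qed

text \<open>The vertices are parameters so that a copy located inside a larger graph can be named by
  its own vertices.\<close>

definition net :: "'a \<Rightarrow> 'a \<Rightarrow> 'a \<Rightarrow> 'a \<Rightarrow> 'a \<Rightarrow> 'a \<Rightarrow> 'a graph" where
  "net a b c x y z = ({a, b, c, x, y, z}, {{a, b}, {b, c}, {c, a}, {a, x}, {b, y}, {c, z}})"

definition square2 :: "'a \<Rightarrow> 'a \<Rightarrow> 'a \<Rightarrow> 'a \<Rightarrow> 'a \<Rightarrow> 'a \<Rightarrow> 'a graph" where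
  "square2 a b c d x y = ({a, b, c, d, x, y}, {{a, b}, {b, c}, {c, d}, {d, a}, {a, x}, {b, y}})"

lemma wf_net:
  assumes "distinct [a, b, c, x, y, z]"
  shows "wf_graph (net a b c x y z)"
proof -
  have "distinct (rev [a, b, c, x, y, z])"
    unfolding distinct_rev by (rule assms)
  with assms show ?thesis
    by (simp add: net_def wf_graph_iff_card)
qed

lemma wf_square2:
  assumes "distinct [a, b, c, d, x, y]"
  shows "wf_graph (square2 a b c d x y)"
proof -
  have "distinct (rev [a, b, c, d, x, y])"
    unfolding distinct_rev by (rule assms)
  with assms show ?thesis
    by (simp add: square2_def wf_graph_iff_card)
qed

lemma net_not_packing_colorable:
  assumes d: "distinct [a, b, c, x, y, z]"
  shows "\<not> packing_colorable (net a b c x y z) 3"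
proof
  let ?G = "net a b c x y z"
  assume "packing_colorable ?G 3"
  then obtain f where f: "packing_coloring ?G 3 f" by (auto simp: packing_colorable_def)
  note wf = wf_net[OF d]
  have "f a \<noteq> 1"
    by (rule branch_vertex_not_1[OF wf f, of a b c x]) (use d in \<open>auto simp: net_def adj_def\<close>)
  moreover have "f b \<noteq> 1"
    by (rule branch_vertex_not_1[OF wf f, of b a c y]) (use d in \<open>auto simp: net_def adj_def\<close>)
  moreover have "f c \<noteq> 1"
    by (rule branch_vertex_not_1[OF wf f, of c a b z]) (use d in \<open>auto simp: net_def adj_def\<close>)
  moreover have "f a \<noteq> f b" "f b \<noteq> f c" "f c \<noteq> f a"
    by (rule packing_coloring_adj[OF wf f]; simp add: net_def adj_def)+
  moreover have "f v = 1 \<or> f v = 2 \<or> f v = 3" if "v \<in> {a, b, c}" for v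
    using packing_coloring_3_cases[OF f, of v] that unfolding net_def by auto
  ultimately show False by (metis insertCI)
qed

text \<open>Deleting a triangle edge leaves a spider; deleting a leaf edge leaves a graph covered by
  the other two triangle vertices.\<close>

lemma critical4_net:
  assumes d: "distinct [a, b, c, x, y, z]"
  shows "critical4 (net a b c x y z)"
proof (rule critical4I[OF wf_net[OF d] net_not_packing_colorable[OF d]])
  show "packing_colorable (net a b c x y z) 4"
    by (rule vertex_cover3_packing_colorable[of _ a b c]) (auto simp: net_def)
  show "\<exists>e\<in>edges (net a b c x y z). v \<in> e" if "v \<in> verts (net a b c x y z)" for v
    using that by (auto simp: net_def)
  fix e assume "e \<in> edges (net a b c x y z)"
  then consider "e = {a, b}" | "e = {b, c}" | "e = {c, a}" | "e = {a, x}" | "e = {b, y}" | "e = {c, z}"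
    by (auto simp: net_def)
  then show "packing_colorable (verts (net a b c x y z), edges (net a b c x y z) - {e}) 3"
  proof cases
    case 1
    have "packing_colorable ({x, a, c, b, y, z}, {{x, a}, {a, c}, {c, b}, {b, y}, {c, z}}) 3"
      by (rule spider_packing_colorable) (use d in auto)
    then show ?thesis
      by (rule packing_colorable_subgraph) (auto simp: net_def 1 insert_commute)
  next
    case 2
    have "packing_colorable ({y, b, a, c, z, x}, {{y, b}, {b, a}, {a, c}, {c, z}, {a, x}}) 3"
      by (rule spider_packing_colorable) (use d in auto)
    then show ?thesis
      by (rule packing_colorable_subgraph) (auto simp: net_def 2 insert_commute)
  next
    case 3
    have "packing_colorable ({x, a, b, c, z, y}, {{x, a}, {a, b}, {b, c}, {c, z}, {b, y}}) 3"
      by (rule spider_packing_colorable) (use d in auto)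
    then show ?thesis
      by (rule packing_colorable_subgraph) (auto simp: net_def 3 insert_commute)
  next
    case 4
    then show ?thesis
      by (intro vertex_cover2_packing_colorable[of _ b c]) (auto simp: net_def)
  next
    case 5
    then show ?thesis
      by (intro vertex_cover2_packing_colorable[of _ a c]) (auto simp: net_def)
  next
    case 6
    then show ?thesis
      by (intro vertex_cover2_packing_colorable[of _ a b]) (auto simp: net_def)
  qed
qed

lemma square2_not_packing_colorable:
  assumes d: "distinct [a, b, c, d, x, y]"
  shows "\<not> packing_colorable (square2 a b c d x y) 3"
proof
  let ?G = "square2 a b c d x y"
  assume "packing_colorable ?G 3"
  then obtain f where f: "packing_coloring ?G 3 f" by (auto simp: packing_colorable_def)
  note wf = wf_square2[OF d]
  have "f a \<noteq> 1"
    by (rule branch_vertex_not_1[OF wf f, of a b d x]) (use d in \<open>auto simp: square2_def adj_def\<close>)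
  moreover have "f b \<noteq> 1"
    by (rule branch_vertex_not_1[OF wf f, of b a c y]) (use d in \<open>auto simp: square2_def adj_def\<close>)
  \<comment> \<open>The prolongation goes through \<open>d\<close>, \<open>c\<close> on one side and
    through \<open>c\<close>, \<open>d\<close> on the other: the same two vertices serve
    both.\<close>
  moreover have "f a = 1 \<longleftrightarrow> f b \<noteq> 1"
    by (rule inner_edge_alternates[OF wf f, of c d a b c d])
      (use d in \<open>auto simp: square2_def adj_def\<close>)
  ultimately show False by blast
qed

text \<open>Deleting \<open>{a, b}\<close> leaves a path, deleting \<open>{b, c}\<close> or
  \<open>{d, a}\<close> a spider; in the other three cases two vertices cover all edges.\<close>

lemma critical4_square2:
  assumes d: "distinct [a, b, c, d, x, y]"
  shows "critical4 (square2 a b c d x y)"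
proof (rule critical4I[OF wf_square2[OF d] square2_not_packing_colorable[OF d]])
  let ?G = "square2 a b c d x y"
  show "packing_colorable ?G 4"
    by (rule vertex_cover3_packing_colorable[of _ a b c]) (auto simp: square2_def)
  show "\<exists>e\<in>edges ?G. v \<in> e" if "v \<in> verts ?G" for v
    using that by (auto simp: square2_def)
  fix e assume "e \<in> edges ?G"
  then consider "e = {a, b}" | "e = {b, c}" | "e = {c, d}" | "e = {d, a}" | "e = {a, x}" | "e = {b, y}"
    by (auto simp: square2_def)
  then show "packing_colorable (verts ?G, edges ?G - {e}) 3"
  proof cases
    case 1
    have "packing_colorable ({x, a, d, c, b, y}, {{x, a}, {a, d}, {d, c}, {c, b}, {b, y}}) 3"
      by (rule path6_packing_colorable) (use d in auto)
    then show ?thesis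
      by (rule packing_colorable_subgraph) (auto simp: square2_def 1 insert_commute)
  next
    case 2
    have "packing_colorable ({y, b, a, d, c, x}, {{y, b}, {b, a}, {a, d}, {d, c}, {a, x}}) 3"
      by (rule spider_packing_colorable) (use d in auto)
    then show ?thesis
      by (rule packing_colorable_subgraph) (auto simp: square2_def 2 insert_commute)
  next
    case 3
    then show ?thesis
      by (intro vertex_cover2_packing_colorable[of _ a b]) (auto simp: square2_def)
  next
    case 4
    have "packing_colorable ({x, a, b, c, d, y}, {{x, a}, {a, b}, {b, c}, {c, d}, {b, y}}) 3"
      by (rule spider_packing_colorable) (use d in auto)
    then show ?thesis
      by (rule packing_colorable_subgraph) (auto simp: square2_def 4 insert_commute)
  next
    case 5
    then show ?thesis
      by (intro vertex_cover2_packing_colorable[of _ b d]) (auto simp: square2_def)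
  next
    case 6
    then show ?thesis
      by (intro vertex_cover2_packing_colorable[of _ a c]) (auto simp: square2_def)
  qed
qed

lemma atLeast0_lessThan_6: "{0..<6} = {0, 1, 2, 3, 4, 5 :: nat}"
  by (simp add: atLeast0LessThan lessThan_nat_numeral lessThan_Suc insert_commute)

lemma cycle_edges_3: "cycle_edges [a, b, c] = {{a, b}, {b, c}, {c, a}}"
proof -
  have "cycle_edges [a, b, c] =
      (\<lambda>i. {[a, b, c] ! i, [a, b, c] ! ((i + 1) mod 3)}) ` {..<3}"
    by (auto simp: cycle_edges_def)
  moreover have "{..<3} = {0, 1, 2 :: nat}"
    by auto
  ultimately show ?thesis by simp
qed

lemma cycle_edges_4: "cycle_edges [a, b, c, d] = {{a, b}, {b, c}, {c, d}, {d, a}}"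
proof -
  have "cycle_edges [a, b, c, d] =
      (\<lambda>i. {[a, b, c, d] ! i, [a, b, c, d] ! ((i + 1) mod 4)}) ` {..<4}"
    by (auto simp: cycle_edges_def)
  moreover have "{..<4} = {0, 1, 2, 3 :: nat}"
    by auto
  ultimately show ?thesis by simp
qed

lemma net_graph_eq: "net_graph = net 0 1 2 3 4 5"
  unfolding net_graph_def net_def cycle_edges_3 atLeast0_lessThan_6
  by (simp only: Un_insert_left Un_empty_left)

lemma C4_two_leaves_eq: "C4_two_leaves = square2 0 1 2 3 4 5"
  unfolding C4_two_leaves_def square2_def cycle_edges_4 atLeast0_lessThan_6
  by (simp only: Un_insert_left Un_empty_left)

lemma graph_iso_net_iff:
  assumes wf: "wf_graph G"
  shows "graph_iso G net_graph \<longleftrightarrow>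
    (\<exists>a b c x y z. distinct [a, b, c, x, y, z] \<and> G = net a b c x y z)" (is "_ \<longleftrightarrow> ?R")
proof -
  have wfN: "wf_graph net_graph"
    unfolding net_graph_eq by (rule wf_net) simp
  have iff: "graph_iso G net_graph \<longleftrightarrow>
      (\<exists>g. inj_on g {0, 1, 2, 3, 4, 5 :: nat} \<and> G = net (g 0) (g 1) (g 2) (g 3) (g 4) (g 5))"
    unfolding graph_iso_iff_map_graph[OF wf wfN]
    by (simp add: net_graph_eq net_def map_graph_def del: inj_on_insert)
  show ?thesis
  proof
    assume "graph_iso G net_graph"
    then obtain g where g: "inj_on g {0, 1, 2, 3, 4, 5 :: nat}"
      "G = net (g 0) (g 1) (g 2) (g 3) (g 4) (g 5)"
      using iff by blast
    have "distinct [g 0, g 1, g 2, g 3, g 4, g 5]"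
      using g(1) by (auto simp: inj_on_def)
    then show ?R using g(2) by blast
  next
    assume ?R
    then obtain a b c x y z where d: "distinct [a, b, c, x, y, z]" and G: "G = net a b c x y z"
      by blast
    let ?g = "(!) [a, b, c, x, y, z]"
    have Geq: "G = net (?g 0) (?g 1) (?g 2) (?g 3) (?g 4) (?g 5)"
      using G by simp
    have "inj_on ?g {0, 1, 2, 3, 4, 5}"
      using d by simp
    then show "graph_iso G net_graph"
      unfolding iff using Geq by blast
  qed
qed

lemma graph_iso_square2_iff:
  assumes wf: "wf_graph G"
  shows "graph_iso G C4_two_leaves \<longleftrightarrow>
    (\<exists>a b c d x y. distinct [a, b, c, d, x, y] \<and> G = square2 a b c d x y)" (is "_ \<longleftrightarrow> ?R")
proof -
  have wfS: "wf_graph C4_two_leaves"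
    unfolding C4_two_leaves_eq by (rule wf_square2) simp
  have iff: "graph_iso G C4_two_leaves \<longleftrightarrow>
      (\<exists>g. inj_on g {0, 1, 2, 3, 4, 5 :: nat} \<and> G = square2 (g 0) (g 1) (g 2) (g 3) (g 4) (g 5))"
    unfolding graph_iso_iff_map_graph[OF wf wfS]
    by (simp add: C4_two_leaves_eq square2_def map_graph_def del: inj_on_insert)
  show ?thesis
  proof
    assume "graph_iso G C4_two_leaves"
    then obtain g where g: "inj_on g {0, 1, 2, 3, 4, 5 :: nat}"
      "G = square2 (g 0) (g 1) (g 2) (g 3) (g 4) (g 5)"
      using iff by blast
    have "distinct [g 0, g 1, g 2, g 3, g 4, g 5]"
      using g(1) by (auto simp: inj_on_def)
    then show ?R using g(2) by blast
  next
    assume ?R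
    then obtain a b c d x y where d: "distinct [a, b, c, d, x, y]" and G: "G = square2 a b c d x y"
      by blast
    let ?g = "(!) [a, b, c, d, x, y]"
    have Geq: "G = square2 (?g 0) (?g 1) (?g 2) (?g 3) (?g 4) (?g 5)"
      using G by simp
    have "inj_on ?g {0, 1, 2, 3, 4, 5}"
      using d by simp
    then show "graph_iso G C4_two_leaves"
      unfolding iff using Geq by blast
  qed
qed

subsection \<open>Cycles\<close>

text \<open>The vertices of an \<open>n\<close>-cycle are indexed periodically by the integers, so that rotating the
  cycle is a shift of the index and no wrap-around case occurs.\<close>
locale cyclic_seq =
  fixes n :: nat and p :: "int \<Rightarrow> 'a"
  assumes n_ge_3: "n \<ge> 3" and p_eq_iff: "p i = p j \<longleftrightarrow> int n dvd (i - j)"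

definition ring_edges :: "(int \<Rightarrow> 'a) \<Rightarrow> 'a set set" where
  "ring_edges p = range (\<lambda>i. {p i, p (i + 1)})"

definition ring_graph :: "(int \<Rightarrow> 'a) \<Rightarrow> 'a graph" where
  "ring_graph p = (range p, ring_edges p)"

context cyclic_seq
begin

lemma p_neq: "0 < \<bar>i - j\<bar> \<Longrightarrow> \<bar>i - j\<bar> < int n \<Longrightarrow> p i \<noteq> p j"
  using p_eq_iff[of i j] dvd_imp_le_int[of "i - j" "int n"] by auto

lemma p_add_n: "p (i + int n) = p i"
  by (simp add: p_eq_iff)

text \<open>\<open>inv p\<close> picks an arbitrary index; the reduction modulo \<open>n\<close>
  makes the result independent of that choice.\<close>

definition pos :: "'a \<Rightarrow> int" where
  "pos v = inv p v mod int n"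

lemma pos_bounds: "0 \<le> pos v" "pos v < int n"
  using n_ge_3 by (simp_all add: pos_def)

lemma p_mod: "p (i mod int n) = p i"
  by (simp add: p_eq_iff mod_eq_dvd_iff[symmetric])

lemma p_pos: "v \<in> range p \<Longrightarrow> p (pos v) = v"
  by (simp add: pos_def p_mod f_inv_into_f)

lemma pos_p: "pos (p i) = i mod int n"
proof -
  have "pos (p i) mod int n = i mod int n"
    using p_pos[OF rangeI, of i] by (simp add: p_eq_iff mod_eq_dvd_iff)
  then show ?thesis by (simp add: pos_def)
qed

lemma finite_range_p: "finite (range p)"
proof -
  have "range p \<subseteq> p ` {0..<int n}"
    using p_pos pos_bounds by (metis atLeastLessThan_iff image_eqI subsetI)
  then show ?thesis by (rule finite_subset) simp
qed

lemma wf_ring_graph: "wf_graph (ring_graph p)"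
proof -
  have "p i \<noteq> p (i + 1)" for i
    using n_ge_3 by (intro p_neq) auto
  then show ?thesis
    using finite_range_p by (auto simp: wf_graph_iff_card ring_graph_def ring_edges_def)
qed

lemma shift: "cyclic_seq n (\<lambda>i. p (i + a))"
  using n_ge_3 by unfold_locales (auto simp: p_eq_iff)

text \<open>Vertices up to three indices apart are distinct once \<open>n \<ge> 4\<close>. Only five
  consecutive edges have to be in \<open>H\<close>, so the lemma also applies after a distant cycle
  edge has been deleted.\<close>

lemma alternates:
  assumes "n \<ge> 4" "wf_graph H" "packing_coloring H 3 c"
    and adj: "\<And>t. i - 2 \<le> t \<Longrightarrow> t \<le> i + 2 \<Longrightarrow> adj H (p t) (p (t + 1))"
  shows "c (p i) = 1 \<longleftrightarrow> c (p (i + 1)) \<noteq> 1"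
proof (rule inner_edge_alternates[OF assms(2,3), of "p (i - 2)" "p (i - 1)" _ _ "p (i + 2)" "p (i + 3)"])
  show "adj H (p (i - 2)) (p (i - 1))" "adj H (p (i - 1)) (p i)" "adj H (p i) (p (i + 1))"
    "adj H (p (i + 1)) (p (i + 2))" "adj H (p (i + 2)) (p (i + 3))"
    using adj[of "i - 2"] adj[of "i - 1"] adj[of i] adj[of "i + 1"] adj[of "i + 2"]
    by (simp_all add: add.assoc)
qed (rule p_neq; use assms(1) in simp)+

lemma ring_graph_not_packing_colorable:
  assumes n: "n \<ge> 4" "\<not> 4 dvd n"
  shows "\<not> packing_colorable (ring_graph p) 3"
proof
  assume "packing_colorable (ring_graph p) 3"
  then obtain c where c: "packing_coloring (ring_graph p) 3 c" by (auto simp: packing_colorable_def)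
  note wf = wf_ring_graph
  have adj: "adj (ring_graph p) (p i) (p (i + 1))" for i
    by (auto simp: adj_def ring_graph_def ring_edges_def)
  have alt: "c (p i) = 1 \<longleftrightarrow> c (p (i + 1)) \<noteq> 1" for i
    by (rule alternates[OF n(1) wf c]) (rule adj)
  \<comment> \<open>Parity of the index decides where colour 1 occurs; at \<open>k = n\<close> the
    walk is back at \<open>p 0\<close>, so \<open>n\<close> is even.\<close>
  have "c (p (int k)) = 1 \<longleftrightarrow> (c (p 0) = 1 \<longleftrightarrow> even k)" for k
  proof (induction k)
    case (Suc k)
    have "int (Suc k) = int k + 1" by simp
    then show ?case using alt[of "int k"] Suc by (metis even_Suc)
  qed simp
  from this[of n] have "even n"
    using p_add_n[of 0] by auto
  obtain i where i: "c (p i) \<noteq> 1" using alt by metis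
  have two: "c (p (j + 2)) \<noteq> 1 \<and> c (p (j + 2)) \<noteq> c (p j)" if "c (p j) \<noteq> 1" for j
  proof -
    have "p j \<noteq> p (j + 2)" using n by (intro p_neq) auto
    then have "c (p j) \<noteq> c (p (j + 2))"
      using packing_coloring_path2[OF wf c adj[of j], of "p (j + 2)"] adj[of "j + 1"] that
      by (auto simp: add.assoc)
    then show ?thesis using alt[of j] alt[of "j + 1"] that by (auto simp: add.assoc)
  qed
  have col: "c (p j) = 1 \<or> c (p j) = 2 \<or> c (p j) = 3" for j
    using packing_coloring_3_cases[OF c, of "p j"] by (auto simp: ring_graph_def)
  have four: "c (p (j + 4)) = c (p j)" if "c (p j) \<noteq> 1" for j
    using two[OF that] two[of "j + 2"] col[of j] col[of "j + 2"] col[of "j + 4"] that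
    by (auto simp: add.assoc)
  have per: "c (p (i + 4 * int k)) = c (p i)" for k
  proof (induction k)
    case (Suc k)
    have "i + 4 * int (Suc k) = (i + 4 * int k) + 4" by simp
    then show ?case using four[of "i + 4 * int k"] Suc i by metis
  qed simp
  \<comment> \<open>Colours other than 1 recur every four steps but change after two. Since
    \<open>n = 4 * m + 2\<close>, one turn around the cycle ends two steps after a recurrence, at
    the starting vertex.\<close>
  define m where "m = n div 4"
  have "n = 4 * m + 2"
    using n \<open>even n\<close> unfolding m_def by presburger
  then have "i + int n = (i + 4 * int m) + 2" by simp
  then have "p i = p ((i + 4 * int m) + 2)" using p_add_n[of i] by metis
  then show False using two[of "i + 4 * int m"] per[of m] i by metis
qed

text \<open>The edge closing the cycle joins positions \<open>n - 1\<close> and 0, so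
  \<open>pos\<close> changes by at most 1 only modulo \<open>n\<close>.\<close>

lemma ring_adjD:
  assumes "adj (ring_graph p) u v"
  shows "\<exists>d. \<bar>d\<bar> \<le> 1 \<and> int n dvd (pos v - pos u - d)"
proof -
  from assms obtain i where "{u, v} = {p i, p (i + 1)}"
    by (auto simp: adj_def ring_graph_def ring_edges_def)
  then consider "u = p i" "v = p (i + 1)" | "u = p (i + 1)" "v = p i"
    by (auto simp: doubleton_eq_iff)
  then show ?thesis
  proof cases
    case 1
    have "((i + 1) mod int n - i mod int n) mod int n = 1 mod int n"
      by (simp add: mod_diff_eq)
    then have "int n dvd ((i + 1) mod int n - i mod int n - 1)"
      by (simp only: mod_eq_dvd_iff)
    then show ?thesis using 1 by (intro exI[of _ 1]) (simp add: pos_p)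
  next
    case 2
    have "(i mod int n - (i + 1) mod int n) mod int n = (-1) mod int n"
      by (simp add: mod_diff_eq)
    then have "int n dvd (i mod int n - (i + 1) mod int n - (-1))"
      by (simp only: mod_eq_dvd_iff)
    then show ?thesis using 2 by (intro exI[of _ "-1"]) (simp add: pos_p)
  qed
qed

text \<open>The pattern 1 2 1 3 from position 0 onwards, with colour 4 used once, at position
  \<open>n - 1\<close>, to separate the two ends of the pattern.\<close>

lemma ring_graph_packing_colorable_4: "packing_colorable (ring_graph p) 4"
proof -
  define h :: "int \<Rightarrow> nat" where
    "h i = (if i = int n - 1 then 4 else if even i then 1 else if i mod 4 = 1 then 2 else 3)" for i
  have h_cases: "h i = 1 \<or> h i = 2 \<or> h i = 3 \<or> h i = 4" for i
    by (auto simp: h_def)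
  have h1: "h i = 1 \<Longrightarrow> even i \<and> i \<noteq> int n - 1"
    and h2: "h i = 2 \<Longrightarrow> i mod 4 = 1 \<and> i \<noteq> int n - 1" for i
    by (simp_all add: h_def split: if_splits)
  have h3: "h i = 3 \<Longrightarrow> i mod 4 = 3 \<and> i \<noteq> int n - 1" for i
    by (simp add: h_def split: if_splits) presburger
  have "packing_coloring (ring_graph p) 4 (\<lambda>v. h (pos v))"
  proof (rule packing_coloringI_displacement[where f = pos and N = "int n"])
    fix u v
    assume uv: "u \<in> verts (ring_graph p)" "v \<in> verts (ring_graph p)" "u \<noteq> v" "h (pos u) = h (pos v)"
    then have ne: "pos u \<noteq> pos v"
      using p_pos[of u] p_pos[of v] by (auto simp: ring_graph_def)
    define a b where "a = pos u" and "b = pos v"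
    have ab: "0 \<le> a" "a < int n" "0 \<le> b" "b < int n" "a \<noteq> b" "h a = h b"
      using pos_bounds ne uv(4) by (auto simp: a_def b_def)
    have "\<bar>d\<bar> > int (h a)" if dv: "int n dvd (b - a - d)" for d
    proof (rule ccontr)
      assume "\<not> \<bar>d\<bar> > int (h a)"
      then have d: "\<bar>d\<bar> \<le> int (h a)" by simp
      have "h a \<noteq> 4" using ab by (auto simp: h_def split: if_splits)
      then have d3: "\<bar>d\<bar> \<le> 3" using d h_cases[of a] by auto
      obtain q where q: "b - a - d = int n * q" using dv unfolding dvd_def by blast
      \<comment> \<open>Since \<open>\<bar>b - a\<bar> < n\<close> and
        \<open>\<bar>d\<bar> \<le> 3\<close>, the absolute value of \<open>n * q\<close> is at most
        \<open>n + 2\<close>, which is below \<open>2 * n\<close>.\<close>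
      have "q < 2"
      proof (rule ccontr)
        assume "\<not> q < 2"
        then have "int n * 2 \<le> int n * q" by (intro mult_left_mono) auto
        then show False using q ab d3 n_ge_3 by linarith
      qed
      moreover have "q > -2"
      proof (rule ccontr)
        assume "\<not> q > -2"
        then have "int n * q \<le> int n * (-2)" by (intro mult_left_mono) auto
        then show False using q ab d3 n_ge_3 by linarith
      qed
      ultimately have "q = -1 \<or> q = 0 \<or> q = 1" by auto
      define N where "N = int n"
      have x: "b - a - d = 0 \<or> b - a - d = N \<or> b - a - d = - N"
        using q \<open>q = -1 \<or> q = 0 \<or> q = 1\<close> by (auto simp: N_def)
      from h_cases[of a] \<open>h a \<noteq> 4\<close> consider "h a = 1" | "h a = 2" | "h a = 3" by blast
      then show False
      proof cases
        case 1
        then have c: "even a" "even b" "a \<le> N - 2" "b \<le> N - 2" "\<bar>d\<bar> \<le> 1"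
          using h1[of a] h1[of b] ab d by (auto simp: N_def)
        have "b - a = d"
          using x c(3-5) ab(1,3) by (elim disjE) linarith+
        then have "\<bar>b - a\<bar> \<le> 1" using c(5) by simp
        then show False using c(1,2) ab(5) by presburger
      next
        case 2
        then have c: "a mod 4 = 1" "b mod 4 = 1" "a \<le> N - 2" "b \<le> N - 2" "\<bar>d\<bar> \<le> 2"
          using h2[of a] h2[of b] ab d by (auto simp: N_def)
        \<comment> \<open>Colour 2 starts at position 1 and all positions are at most
          \<open>N - 2\<close>, so going around the closing edge takes at least 3 steps and only
          \<open>q = 0\<close> remains. Colour 3 is treated likewise, starting at position
          3.\<close>
        have lo: "a \<ge> 1" "b \<ge> 1"
          using c(1) ab(1) c(2) ab(3) by presburger+
        have "b - a = d"
          using x c(3-5) ab(1,3) lo by (elim disjE) linarith+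
        then have "\<bar>b - a\<bar> \<le> 2" using c(5) by simp
        then show False using c(1,2) ab(5) by presburger
      next
        case 3
        then have c: "a mod 4 = 3" "b mod 4 = 3" "a \<le> N - 2" "b \<le> N - 2" "\<bar>d\<bar> \<le> 3"
          using h3[of a] h3[of b] ab d by (auto simp: N_def)
        have lo: "a \<ge> 3" "b \<ge> 3"
          using c(1) ab(1) c(2) ab(3) by presburger+
        have "b - a = d"
          using x c(3-5) ab(1,3) lo by (elim disjE) linarith+
        then have "\<bar>b - a\<bar> \<le> 3" using c(5) by simp
        then show False using c(1,2) ab(5) by presburger
      qed
    qed
    then show "h (pos u) = 1 \<and> \<not> adj (ring_graph p) u v \<or>
        (\<forall>d. int n dvd (pos v - pos u - d) \<longrightarrow> \<bar>d\<bar> > int (h (pos u)))"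
      by (simp add: a_def b_def)
  next
    fix v show "h (pos v) \<in> {1..4}" using h_cases[of "pos v"] by auto
  qed (rule ring_adjD)
  then show ?thesis by (auto simp: packing_colorable_def)
qed

text \<open>The deleted edge is the only one across which \<open>pos\<close> wraps around.
  Afterwards positions behave as on a line, where the pattern 1 2 1 3 works for every
  length.\<close>

lemma ring_graph_delete_last_edge:
  "packing_colorable (range p, ring_edges p - {{p (-1), p 0}}) 3"
proof -
  define h :: "int \<Rightarrow> nat" where
    "h i = (if even i then 1 else if i mod 4 = 1 then 2 else 3)" for i
  let ?H = "(range p, ring_edges p - {{p (-1), p 0}})"
  have step: "pos (p (i + 1)) = pos (p i) + 1" if "{p i, p (i + 1)} \<noteq> {p (-1), p 0}" for i
  proof -
    have "\<not> int n dvd (i + 1)"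
    proof
      assume "int n dvd (i + 1)"
      then have "p i = p (-1)" "p (i + 1) = p 0" by (simp_all add: p_eq_iff)
      then show False using that by simp
    qed
    then have "(i + 1) mod int n \<noteq> 0" by (simp add: mod_eq_0_iff_dvd)
    moreover have "(i + 1) mod int n = (i mod int n + 1) mod int n" by (simp add: mod_simps)
    moreover have "i mod int n + 1 \<le> int n" "0 \<le> i mod int n"
      using n_ge_3 by (simp_all add: add1_zle_eq)
    ultimately show ?thesis
      unfolding pos_p by (cases "i mod int n + 1 = int n") auto
  qed
  have "packing_coloring ?H 3 (\<lambda>v. h (pos v))"
  proof (rule packing_coloringI_lipschitz[where f = pos])
    show "\<forall>v\<in>verts ?H. 1 \<le> h (pos v) \<and> h (pos v) \<le> 3" by (auto simp: h_def)
    show "\<forall>e\<in>edges ?H. \<forall>u\<in>e. \<forall>v\<in>e. \<bar>pos u - pos v\<bar> \<le> 1"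
    proof (intro ballI)
      fix e u v assume e: "e \<in> edges ?H" and uv: "u \<in> e" "v \<in> e"
      then obtain i where i: "e = {p i, p (i + 1)}" by (auto simp: ring_edges_def)
      then have "pos (p (i + 1)) = pos (p i) + 1" using e by (intro step) auto
      then show "\<bar>pos u - pos v\<bar> \<le> 1" using uv i by auto
    qed
    show "\<forall>u\<in>verts ?H. \<forall>v\<in>verts ?H. h (pos u) = h (pos v) \<longrightarrow> u = v \<or>
        h (pos u) = 1 \<and> {u, v} \<notin> edges ?H \<or> \<bar>pos u - pos v\<bar> > int (h (pos u))"
    proof (intro ballI impI)
      fix u v assume uv: "u \<in> verts ?H" "v \<in> verts ?H" "h (pos u) = h (pos v)"
      have "\<bar>a - b\<bar> > int (h a)" if "a \<noteq> b" "h a = h b" for a b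
        using that by (auto simp: h_def split: if_splits; presburger)
      then have "\<bar>pos u - pos v\<bar> > int (h (pos u))" if "u \<noteq> v"
        using that uv p_pos[of u] p_pos[of v] by (metis verts_Pair)
      then show "u = v \<or> h (pos u) = 1 \<and> {u, v} \<notin> edges ?H \<or> \<bar>pos u - pos v\<bar> > int (h (pos u))"
        by blast
    qed
  qed
  then show ?thesis by (auto simp: packing_colorable_def)
qed

lemma range_shift: "range (\<lambda>i. p (i + a)) = range p"
proof -
  have "p i \<in> range (\<lambda>i. p (i + a))" for i
    by (rule range_eqI[of _ _ "i - a"]) simp
  then show ?thesis by auto
qed

lemma ring_edges_shift: "ring_edges (\<lambda>i. p (i + a)) = ring_edges p"
proof -
  have "{p i, p (i + 1)} = {p ((i - a) + a), p ((i - a + 1) + a)}" for i by (simp add: algebra_simps)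
  then have "ring_edges p \<subseteq> ring_edges (\<lambda>i. p (i + a))"
    unfolding ring_edges_def by blast
  moreover have "{p (i + a), p (i + 1 + a)} = {p (i + a), p ((i + a) + 1)}" for i
    by (simp add: algebra_simps)
  then have "ring_edges (\<lambda>i. p (i + a)) \<subseteq> ring_edges p"
    unfolding ring_edges_def by blast
  ultimately show ?thesis by blast
qed

lemma critical4_ring_graph:
  assumes n: "n \<ge> 4" "\<not> 4 dvd n"
  shows "critical4 (ring_graph p)"
proof (rule critical4I[OF wf_ring_graph ring_graph_not_packing_colorable[OF n]
      ring_graph_packing_colorable_4])
  show "\<exists>e\<in>edges (ring_graph p). v \<in> e" if "v \<in> verts (ring_graph p)" for v
    using that by (auto simp: ring_graph_def ring_edges_def)
  fix e assume "e \<in> edges (ring_graph p)"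
  then obtain i where e: "e = {p i, p (i + 1)}"
    by (auto simp: ring_graph_def ring_edges_def)
  \<comment> \<open>Rotation by \<open>i + 1\<close> moves the deleted edge to the indices -1 and
    0.\<close>
  interpret s: cyclic_seq n "\<lambda>j. p (j + (i + 1))" by (rule shift)
  show "packing_colorable (verts (ring_graph p), edges (ring_graph p) - {e}) 3"
    using s.ring_graph_delete_last_edge range_shift[of "i + 1"] ring_edges_shift[of "i + 1"]
    by (simp add: ring_graph_def e)
qed

end

section \<open>From indices below n to periodic indices\<close>

lemma cyclic_seq_of_inj:
  fixes g :: "nat \<Rightarrow> 'a"
  assumes n: "n \<ge> 3" and inj: "inj_on g {0..<n}"
  defines "p \<equiv> (\<lambda>i. g (nat (i mod int n)))"
  shows "cyclic_seq n p" and "range p = g ` {0..<n}"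
    and "ring_edges p = {{g i, g ((i + 1) mod n)} | i. i < n}"
proof -
  have in_range: "nat (i mod int n) \<in> {0..<n}" for i
    using n by (simp add: nat_less_iff)
  show "cyclic_seq n p"
  proof
    fix i j
    have "p i = p j \<longleftrightarrow> nat (i mod int n) = nat (j mod int n)"
      unfolding p_def using inj_on_eq_iff[OF inj in_range in_range] .
    also have "\<dots> \<longleftrightarrow> i mod int n = j mod int n"
      using n by (simp add: eq_nat_nat_iff)
    finally show "p i = p j \<longleftrightarrow> int n dvd (i - j)" by (simp add: mod_eq_dvd_iff)
  qed (rule n)
  have p_int: "p (int k) = g k" if "k < n" for k
    using that by (simp add: p_def)
  show "range p = g ` {0..<n}"
  proof (intro equalityI subsetI)
    fix v assume "v \<in> range p"
    then show "v \<in> g ` {0..<n}" using in_range by (auto simp: p_def)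
  next
    fix v assume "v \<in> g ` {0..<n}"
    then obtain k where "k < n" "v = g k" by auto
    then have "v = p (int k)" using p_int by simp
    then show "v \<in> range p" by simp
  qed
  have p_Suc: "p (i + 1) = g ((nat (i mod int n) + 1) mod n)" for i
  proof -
    have "int ((nat (i mod int n) + 1) mod n) = (i mod int n + 1) mod int n"
      using n by (simp add: zmod_int add.commute)
    also have "\<dots> = (i + 1) mod int n" by (simp add: mod_simps)
    finally show ?thesis unfolding p_def by (metis nat_int)
  qed
  show "ring_edges p = {{g i, g ((i + 1) mod n)} | i. i < n}"
  proof (intro equalityI subsetI)
    fix e assume "e \<in> ring_edges p"
    then obtain i where "e = {p i, p (i + 1)}" by (auto simp: ring_edges_def)
    then have "e = {g (nat (i mod int n)), g ((nat (i mod int n) + 1) mod n)}"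
      using p_Suc[of i] by (simp add: p_def)
    then show "e \<in> {{g i, g ((i + 1) mod n)} | i. i < n}" using in_range[of i] by auto
  next
    fix e assume "e \<in> {{g i, g ((i + 1) mod n)} | i. i < n}"
    then obtain k where k: "k < n" "e = {g k, g ((k + 1) mod n)}" by blast
    then have "e = {p (int k), p (int k + 1)}"
      using p_int[of k] p_Suc[of "int k"] by simp
    then show "e \<in> ring_edges p" by (auto simp: ring_edges_def)
  qed
qed

lemma map_graph_cycle_graph:
  "map_graph g (cycle_graph n) = (g ` {0..<n}, {{g i, g ((i + 1) mod n)} | i. i < n})"
proof -
  have "cycle_edges [0..<n] = (\<lambda>i. {i, (i + 1) mod n}) ` {i. i < n}"
    by (force simp: cycle_edges_def)
  then show ?thesis
    by (auto simp: map_graph_def cycle_graph_def image_image)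
qed

lemma ring_graph_of_inj:
  assumes "n \<ge> 3" "inj_on g {0..<n}"
  shows "ring_graph (\<lambda>i. g (nat (i mod int n))) = map_graph g (cycle_graph n)"
  unfolding ring_graph_def map_graph_cycle_graph cyclic_seq_of_inj(2,3)[OF assms] ..

lemma graph_iso_cycle_graph_iff:
  assumes n: "n \<ge> 3" and wf: "wf_graph G"
  shows "graph_iso G (cycle_graph n) \<longleftrightarrow> (\<exists>p. cyclic_seq n p \<and> G = ring_graph p)"
proof -
  have "wf_graph (map_graph id (cycle_graph n))"
    using cyclic_seq.wf_ring_graph[OF cyclic_seq_of_inj(1)[OF n inj_on_id]]
    unfolding ring_graph_of_inj[OF n inj_on_id] .
  then have wfc: "wf_graph (cycle_graph n)"
    by (simp add: map_graph_def verts_def edges_def)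
  have verts: "verts (cycle_graph n) = {0..<n}" by (simp add: cycle_graph_def)
  show ?thesis
    unfolding graph_iso_iff_map_graph[OF wf wfc] verts
  proof
    assume "\<exists>g. inj_on g {0..<n} \<and> G = map_graph g (cycle_graph n)"
    then obtain g where inj: "inj_on g {0..<n}" and G: "G = map_graph g (cycle_graph n)" by blast
    show "\<exists>p. cyclic_seq n p \<and> G = ring_graph p"
      using cyclic_seq_of_inj(1)[OF n inj] ring_graph_of_inj[OF n inj] G by metis
  next
    assume "\<exists>p. cyclic_seq n p \<and> G = ring_graph p"
    then obtain p where p: "cyclic_seq n p" and G: "G = ring_graph p" by blast
    interpret cyclic_seq n p by (rule p)
    have inj: "inj_on (\<lambda>k. p (int k)) {0..<n}"
    proof (rule inj_onI)
      fix x y assume "x \<in> {0..<n}" "y \<in> {0..<n}" "p (int x) = p (int y)"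
      then show "x = y" using p_neq[of "int x" "int y"] by fastforce
    qed
    have "(\<lambda>i. p (int (nat (i mod int n)))) = p"
      using n by (simp add: p_mod)
    then have "G = map_graph (\<lambda>k. p (int k)) (cycle_graph n)"
      using ring_graph_of_inj[OF n inj] G by simp
    then show "\<exists>g. inj_on g {0..<n} \<and> G = map_graph g (cycle_graph n)"
      using inj by blast
  qed
qed

subsection \<open>Cycles with leaves\<close>

locale crown = cyclic_seq n p for n and p :: "int \<Rightarrow> 'a" +
  fixes G :: "'a graph" and L :: "'a set" and att :: "'a \<Rightarrow> 'a"
  assumes finite_L: "finite L" and L_disjoint: "L \<inter> range p = {}"
    and att_in: "\<And>l. l \<in> L \<Longrightarrow> att l \<in> range p"
    and verts_G: "verts G = range p \<union> L"
    and edges_G: "edges G = ring_edges p \<union> {{l, att l} | l. l \<in> L}"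

lemma classC_crown:
  assumes "G \<in> classC"
  obtains n p L att where "crown n p G L att"
proof -
  from assms obtain cs L att where cs: "distinct cs" "length cs \<ge> 3"
    and L: "finite L" "L \<inter> set cs = {}" "\<forall>l\<in>L. att l \<in> set cs"
    and G: "verts G = set cs \<union> L" "edges G = cycle_edges cs \<union> {{l, att l} | l. l \<in> L}"
    unfolding classC_def mem_Collect_eq by (elim exE conjE) (rule that; assumption)
  let ?n = "length cs"
  let ?p = "\<lambda>i. cs ! nat (i mod int ?n)"
  have inj: "inj_on ((!) cs) {0..<?n}"
    using cs(1) by (simp add: inj_on_nth)
  note c = cyclic_seq_of_inj[OF cs(2) inj]
  have r: "range ?p = set cs"
    unfolding c(2) by (auto simp: set_conv_nth)
  have "ring_edges ?p = cycle_edges cs"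
    unfolding c(3) cycle_edges_def ..
  then have "crown ?n ?p G L att"
    using L G r by (intro crown.intro crown_axioms.intro c(1)) auto
  then show thesis by (rule that)
qed

context crown
begin

lemma L_not_p: "l \<in> L \<Longrightarrow> l \<noteq> p i"
  using L_disjoint by blast

lemma leaf_edge: "l \<in> L \<Longrightarrow> {att l, l} \<in> edges G"
  unfolding edges_G by (subst insert_commute) blast

lemma ring_edge: "{p i, p (i + 1)} \<in> edges G"
  by (auto simp: edges_G ring_edges_def)

lemma wf_G: "wf_graph G"
proof -
  have "p i \<noteq> p (i + 1)" for i
    using n_ge_3 by (intro p_neq) auto
  moreover have "l \<noteq> att l" if "l \<in> L" for l
    using att_in[OF that] L_disjoint that by auto
  ultimately show ?thesis
    using finite_range_p finite_L att_in
    by (auto simp: wf_graph_iff_card verts_G edges_G ring_edges_def)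
qed

text \<open>Rotation changes only the indexing and not \<open>G\<close>, so a chosen attachment
  vertex may be taken as \<open>p 0\<close>.\<close>

lemma shift_crown: "crown n (\<lambda>i. p (i + a)) G L att"
proof (intro crown.intro crown_axioms.intro shift)
qed (use finite_L L_disjoint att_in verts_G edges_G in \<open>simp_all add: range_shift ring_edges_shift\<close>)

lemma ring_graph_subgraph: "verts (ring_graph p) \<subseteq> verts G" "edges (ring_graph p) \<subseteq> edges G"
  by (auto simp: ring_graph_def verts_G edges_G)

text \<open>Colour 1 goes to the leaves and the odd cycle positions. With all leaves at even
  positions these are pairwise nonadjacent, and \<open>4 dvd n\<close> lets the colours 2 and 3
  alternate consistently on the even positions.\<close>

lemma packing_colorable_even_leaves:
  assumes n4: "4 dvd n" and even: "\<And>l. l \<in> L \<Longrightarrow> \<exists>i. even i \<and> att l = p i"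
  shows "packing_colorable G 3"
proof -
  \<comment> \<open>A leaf takes the position of its cycle vertex, so leaf edges have displacement
    0. Sharing a position is harmless: leaves have colour 1, where only nonadjacency is
    checked.\<close>
  define f where "f v = pos (if v \<in> L then att v else v)" for v
  define h :: "'a \<Rightarrow> nat" where
    "h v = (if v \<in> L \<or> odd (f v) then 1 else if f v mod 4 = 0 then 2 else 3)" for v
  have n4': "4 dvd int n" using n4 by presburger
  have mod4: "pos (p i) mod 4 = i mod 4" for i
    using n4' by (simp add: pos_p mod_mod_cancel)
  have par: "even (pos (p i)) \<longleftrightarrow> even i" for i
    using mod4[of i] by presburger
  have f_p: "f (p i) = pos (p i)" for i
    using L_not_p[of "p i" i] by (auto simp: f_def)
  have f_att: "f (att l) = f l" if "l \<in> L" for l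
  proof -
    obtain i where "att l = p i" using att_in[OF \<open>l \<in> L\<close>] by blast
    then show ?thesis using that f_p[of i] by (simp add: f_def[of l])
  qed
  have f_leaf: "even (f l)" if "l \<in> L" for l
  proof -
    obtain i where "even i" "att l = p i" using even[OF \<open>l \<in> L\<close>] by blast
    then show ?thesis using that by (simp add: f_def par)
  qed
  have h_cases: "h v = 1 \<or> h v = 2 \<or> h v = 3" for v by (auto simp: h_def)
  have "packing_coloring G 3 h"
  proof (rule packing_coloringI_displacement[where f = f and N = "int n"])
    show "h v \<in> {1..3}" for v using h_cases[of v] by auto
  next
    fix u v assume "adj G u v"
    then consider "adj (ring_graph p) u v" | "u \<in> L" "v = att u" | "v \<in> L" "u = att v"
      by (auto simp: adj_def edges_G ring_graph_def doubleton_eq_iff)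
    then show "\<exists>d. \<bar>d\<bar> \<le> 1 \<and> int n dvd (f v - f u - d)"
    proof cases
      case 1
      then have "u \<in> range p" "v \<in> range p"
        using adj_wfD[OF wf_ring_graph] by (auto simp: ring_graph_def)
      then have "f u = pos u" "f v = pos v" by (auto simp: f_p)
      then show ?thesis using ring_adjD[OF 1] by simp
    next
      case 2
      then have "f v = f u" using f_att by simp
      then show ?thesis by (intro exI[of _ 0]) simp
    next
      case 3
      then have "f v = f u" using f_att by simp
      then show ?thesis by (intro exI[of _ 0]) simp
    qed
  next
    fix u v assume uv: "u \<in> verts G" "v \<in> verts G" "u \<noteq> v" "h u = h v"
    show "h u = 1 \<and> \<not> adj G u v \<or> (\<forall>d. int n dvd (f v - f u - d) \<longrightarrow> \<bar>d\<bar> > int (h u))"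
    proof (cases "h u = 1")
      case True
      have one: "h (p i) = 1 \<longleftrightarrow> odd i" for i
        using L_not_p[of "p i" i] by (auto simp: h_def f_p par)
      have "\<not> adj G u v"
      proof
        assume "adj G u v"
        then consider i where "{u, v} = {p i, p (i + 1)}" | l where "l \<in> L" "{u, v} = {l, att l}"
          by (auto simp: adj_def edges_G ring_edges_def)
        then show False
        proof cases
          case 1
          then have "h (p i) = 1" "h (p (i + 1)) = 1"
            using True uv(4) by (auto simp: doubleton_eq_iff)
          then show False using one[of i] one[of "i + 1"] by simp
        next
          case 2
          then have "h (att l) = 1" using True uv(4) by (auto simp: doubleton_eq_iff)
          then show False using even[OF 2(1)] one by metis
        qed
      qed
      then show ?thesis using True by simp
    next
      case False
      then have nl: "u \<notin> L" "v \<notin> L" "even (f u)" "even (f v)"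
        using uv(4) by (auto simp: h_def split: if_splits)
      then have r: "u \<in> range p" "v \<in> range p" using uv verts_G by auto
      then have fp: "f u = pos u" "f v = pos v" by (auto simp: f_p)
      have "h u \<le> 3" using h_cases[of u] by auto
      \<comment> \<open>Equal colours other than 1 mean positions congruent modulo 4. As
        \<open>4 dvd n\<close>, every displacement is then a multiple of 4, and one of size at most
        3 is 0, which would give \<open>u = v\<close>.\<close>
      have four: "f u mod 4 = f v mod 4"
        using False uv(4) nl by (simp add: h_def split: if_splits) presburger
      have "\<bar>d\<bar> > int (h u)" if "int n dvd (f v - f u - d)" for d
      proof (rule ccontr)
        assume "\<not> \<bar>d\<bar> > int (h u)"
        then have "\<bar>d\<bar> \<le> 3" using \<open>h u \<le> 3\<close> by simp
        moreover have "4 dvd (f v - f u - d)" using n4' that by (rule dvd_trans)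
        ultimately have "d = 0" using four by presburger
        then have "int n dvd (pos v - pos u)" using that fp by simp
        then have "p (pos v) = p (pos u)" by (simp add: p_eq_iff)
        then show False using p_pos r uv(3) by metis
      qed
      then show ?thesis by blast
    qed
  qed
  then show ?thesis by (auto simp: packing_colorable_def)
qed

text \<open>After rotating some leaf to index 0, not all leaves can sit at even indices, since
  otherwise \<open>G\<close> would be 3-colourable.\<close>

lemma leaves_at_odd_distance:
  assumes n4: "4 dvd n" and nc: "\<not> packing_colorable G 3"
  obtains l1 l2 i k where "l1 \<in> L" "l2 \<in> L" "att l1 = p i" "att l2 = p (i + k)"
    "odd k" "0 < k" "2 * k \<le> int n"
proof -
  have "L \<noteq> {}" using nc packing_colorable_even_leaves[OF n4] by auto
  then obtain l1 i where l1: "l1 \<in> L" "att l1 = p i" using att_in by blast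
  interpret s: crown n "\<lambda>j. p (j + i)" G L att by (rule shift_crown)
  obtain l2 where l2: "l2 \<in> L" "\<And>j. att l2 = p (j + i) \<Longrightarrow> odd j"
    using nc s.packing_colorable_even_leaves[OF n4] by blast
  obtain j where j: "att l2 = p j" using att_in[OF l2(1)] by blast
  define k where "k = (j - i) mod int n"
  have "p (k + i) = p j"
  proof -
    have "int n dvd (k - (j - i))" unfolding k_def by (simp add: mod_eq_dvd_iff[symmetric])
    then show ?thesis by (simp add: p_eq_iff algebra_simps)
  qed
  then have k: "att l2 = p (i + k)" "odd k" using j l2(2) by (simp_all add: add.commute)
  have k_bounds: "0 \<le> k" "k < int n" using n_ge_3 by (simp_all add: k_def)
  have "k \<noteq> 0" using k(2) by auto
  show thesis
  proof (cases "2 * k \<le> int n")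
    case True
    then show ?thesis using that[OF l1(1) l2(1) l1(2) k(1,2)] k_bounds \<open>k \<noteq> 0\<close> by simp
  next
    case False
    \<comment> \<open>The complementary arc is the shorter one; its length is odd as well because
      \<open>n\<close> is even, and the two leaves exchange roles.\<close>
    have "p ((i + k) + (int n - k)) = p i" using p_add_n[of i] by (simp add: algebra_simps)
    moreover have "odd (int n - k)" using k(2) n4 by presburger
    ultimately show ?thesis
      using that[OF l2(1) l1(1) k(1), of "int n - k"] l1(2) False k_bounds by simp
  qed
qed

section \<open>Necessity: locating an obstruction in a critical graph\<close>

text \<open>If one triangle vertex has no leaf, the other two cover every edge.\<close>

lemma packing_colorable_triangle:
  assumes n: "n = 3" and k: "p k \<notin> att ` L"
  shows "packing_colorable G 3"
proof (rule vertex_cover2_packing_colorable[of _ "p (k + 1)" "p (k + 2)"])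
  have cases: "p i = p k \<or> p i = p (k + 1) \<or> p i = p (k + 2)" for i
    unfolding p_eq_iff n by presburger
  fix e assume "e \<in> edges G"
  then consider i where "e = {p i, p (i + 1)}" | l where "l \<in> L" "e = {l, att l}"
    by (auto simp: edges_G ring_edges_def)
  then show "p (k + 1) \<in> e \<or> p (k + 2) \<in> e"
  proof cases
    case 1
    have "p i \<noteq> p (i + 1)" using n by (intro p_neq) auto
    then show ?thesis using cases[of i] cases[of "i + 1"] 1 by auto
  next
    case 2
    obtain i where i: "att l = p i" using att_in[OF 2(1)] by blast
    have "att l \<noteq> p k" using k 2(1) by (metis imageI)
    then show ?thesis using cases[of i] 2 i by auto
  qed
qed

text \<open>The form in which criticality is exploited: exhibiting an obstruction inside
  \<open>G\<close> already identifies \<open>G\<close>.\<close>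

lemma critical4_subgraph_eq:
  assumes "critical4 G" "wf_graph H" "verts H \<subseteq> verts G" "edges H \<subseteq> edges G"
    "\<not> packing_colorable H 3"
  shows "G = H"
  using critical4D(2)[OF assms(1) wf_G, of H] assms(2-5) by (auto simp: proper_subgraph_def)

lemma critical4_triangle:
  assumes crit: "critical4 G" and n: "n = 3"
  shows "\<exists>a b c x y z. distinct [a, b, c, x, y, z] \<and> G = net a b c x y z"
proof -
  have "\<forall>k. \<exists>l. l \<in> L \<and> att l = p k"
  proof
    fix k
    have "p k \<in> att ` L"
      using packing_colorable_triangle[OF n] critical4D(1)[OF crit wf_G] by blast
    then show "\<exists>l. l \<in> L \<and> att l = p k"
      by (rule imageE) (intro exI conjI, auto)
  qed
  from choice[OF this] obtain l where l: "\<And>k. l k \<in> L" "\<And>k. att (l k) = p k"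
    by blast
  have ne: "p 0 \<noteq> p 1" "p 0 \<noteq> p 2" "p 1 \<noteq> p 2"
    using n by (intro p_neq; simp)+
  then have "l 0 \<noteq> l 1" "l 0 \<noteq> l 2" "l 1 \<noteq> l 2" using l(2) by metis+
  moreover have "p i \<noteq> l k" for i k using L_not_p[OF l(1)] by metis
  ultimately have d: "distinct [p 0, p 1, p 2, l 0, l 1, l 2]" using ne by auto
  let ?H = "net (p 0) (p 1) (p 2) (l 0) (l 1) (l 2)"
  from ring_edge[of 0] ring_edge[of 1] ring_edge[of 2] p_add_n[of 0]
  have "{p 0, p 1} \<in> edges G" "{p 1, p 2} \<in> edges G" "{p 2, p 0} \<in> edges G"
    using n by simp_all
  moreover have "{p k, l k} \<in> edges G" for k
    using leaf_edge[OF l(1)] l(2) by metis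
  ultimately have "edges ?H \<subseteq> edges G" by (simp add: net_def)
  moreover have "verts ?H \<subseteq> verts G" using l(1) by (auto simp: net_def verts_G)
  ultimately have "G = ?H"
    using critical4_subgraph_eq[OF crit wf_net[OF d]] net_not_packing_colorable[OF d] by blast
  then show ?thesis using d by blast
qed

lemma critical4_square:
  assumes crit: "critical4 G" and n: "n = 4"
  shows "\<exists>a b c d x y. distinct [a, b, c, d, x, y] \<and> G = square2 a b c d x y"
proof -
  have "4 dvd n" using n by simp
  then obtain x y i k where xy: "x \<in> L" "y \<in> L" "att x = p i" "att y = p (i + k)"
    and k: "odd k" "0 < k" "2 * k \<le> int n"
    using leaves_at_odd_distance critical4D(1)[OF crit wf_G] by metis
  \<comment> \<open>Odd with \<open>2 * k \<le> 4\<close>: the two attachment vertices are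
    adjacent.\<close>
  have "k = 1" using k n by presburger
  have ne: "p i \<noteq> p (i + 1)" "p i \<noteq> p (i + 2)" "p i \<noteq> p (i + 3)"
    "p (i + 1) \<noteq> p (i + 2)" "p (i + 1) \<noteq> p (i + 3)" "p (i + 2) \<noteq> p (i + 3)"
    using n by (intro p_neq; simp)+
  have "x \<noteq> y" using xy ne(1) \<open>k = 1\<close> by auto
  moreover have "p j \<noteq> x" "p j \<noteq> y" for j using L_not_p xy by metis+
  ultimately have d: "distinct [p i, p (i + 1), p (i + 2), p (i + 3), x, y]" using ne by auto
  let ?H = "square2 (p i) (p (i + 1)) (p (i + 2)) (p (i + 3)) x y"
  from ring_edge[of i] ring_edge[of "i + 1"] ring_edge[of "i + 2"] ring_edge[of "i + 3"] p_add_n[of i]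
  have "{p i, p (i + 1)} \<in> edges G" "{p (i + 1), p (i + 2)} \<in> edges G"
    "{p (i + 2), p (i + 3)} \<in> edges G" "{p (i + 3), p i} \<in> edges G"
    using n by (simp_all add: add.assoc)
  moreover have "{p i, x} \<in> edges G" "{p (i + 1), y} \<in> edges G"
    using leaf_edge[OF xy(1)] leaf_edge[OF xy(2)] xy(3,4) \<open>k = 1\<close> by simp_all
  ultimately have "edges ?H \<subseteq> edges G" by (simp add: square2_def)
  moreover have "verts ?H \<subseteq> verts G" using xy by (auto simp: square2_def verts_G)
  ultimately have "G = ?H"
    using critical4_subgraph_eq[OF crit wf_square2[OF d]] square2_not_packing_colorable[OF d] by blast
  then show ?thesis using d by blast
qed

text \<open>The deleted edge lies far enough from both branch vertices that the colours still alternate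
  between 1 and \<open>{2, 3}\<close> on the arc joining them, so one of them gets colour 1.\<close>
lemma not_packing_colorable_delete_edge:
  assumes x: "x \<in> L" "att x = p 0" and y: "y \<in> L" "att y = p k"
    and k: "odd k" "0 < k" "k + 5 \<le> int n"
  shows "\<not> packing_colorable (verts G, edges G - {{p (k + 2), p (k + 3)}}) 3"
proof
  let ?H = "(verts G, edges G - {{p (k + 2), p (k + 3)}})"
  assume "packing_colorable ?H 3"
  then obtain c where c: "packing_coloring ?H 3 c" by (auto simp: packing_colorable_def)
  have wf: "wf_graph ?H" using wf_G by (auto simp: wf_graph_iff_card)
  \<comment> \<open>These are the edges that alternation uses along the arc, two beyond each end. As
    \<open>k + 5 \<le> n\<close>, the deleted edge is none of them; at worst
    \<open>p (k + 3)\<close> coincides with \<open>p (-2)\<close>.\<close>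
  have adj_p: "adj ?H (p t) (p (t + 1))" if t: "-2 \<le> t" "t < k + 2" for t
  proof -
    have "p t \<noteq> p (k + 2)" using t k by (intro p_neq) auto
    moreover have "p (t + 1) \<noteq> p (k + 2) \<or> p t \<noteq> p (k + 3)"
    proof (cases "t = k + 1")
      case True
      then have "p t \<noteq> p (k + 3)" using k by (intro p_neq) auto
      then show ?thesis by simp
    next
      case False
      then have "p (t + 1) \<noteq> p (k + 2)" using t k by (intro p_neq) auto
      then show ?thesis by simp
    qed
    ultimately have "{p t, p (t + 1)} \<noteq> {p (k + 2), p (k + 3)}"
      by (auto simp: doubleton_eq_iff)
    then show ?thesis using ring_edge[of t] by (simp add: adj_def)
  qed
  have adj_leaf: "adj ?H (att l) l" if "l \<in> L" for l
  proof -
    have "{att l, l} \<noteq> {p (k + 2), p (k + 3)}"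
      using L_not_p[OF that] by (auto simp: doubleton_eq_iff)
    then show ?thesis using leaf_edge[OF that] by (simp add: adj_def)
  qed
  have branch: "c (p i) \<noteq> 1" if "l \<in> L" "att l = p i" "0 \<le> i" "i \<le> k" for l i
  proof (rule branch_vertex_not_1[OF wf c])
    show "adj ?H (p i) (p (i - 1))" using adj_p[of "i - 1"] that by (simp add: adj_commute)
    show "adj ?H (p i) (p (i + 1))" using adj_p[of i] that by simp
    show "adj ?H (p i) l" using adj_leaf[OF that(1)] that(2) by simp
    show "p (i - 1) \<noteq> p (i + 1)" using k by (intro p_neq) auto
    show "p (i - 1) \<noteq> l" "p (i + 1) \<noteq> l" using L_not_p[OF that(1)] by metis+
  qed
  have alt: "c (p i) = 1 \<longleftrightarrow> c (p (i + 1)) \<noteq> 1" if "0 \<le> i" "i < k" for i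
    by (rule alternates[OF _ wf c]) (use that k in \<open>auto intro: adj_p\<close>)
  have "int m \<le> k \<Longrightarrow> c (p (int m)) = 1 \<longleftrightarrow> (c (p 0) = 1 \<longleftrightarrow> even m)" for m
  proof (induction m)
    case (Suc m)
    have "int (Suc m) = int m + 1" by simp
    then show ?case using alt[of "int m"] Suc by (metis even_Suc of_nat_0_le_iff zless_add1_eq order_le_less less_add_one order_less_le_trans)
  qed simp
  from this[of "nat k"] have "c (p k) = 1 \<longleftrightarrow> c (p 0) \<noteq> 1"
    using k by (auto simp: even_nat_iff)
  then show False using branch[OF x] branch[OF y] k by auto
qed

lemma critical4_not_dvd:
  assumes crit: "critical4 G" and n: "n \<ge> 8"
  shows "\<not> 4 dvd n"
proof
  assume n4: "4 dvd n"
  then obtain x y i k where xy: "x \<in> L" "y \<in> L" "att x = p i" "att y = p (i + k)"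
    and k: "odd k" "0 < k" "2 * k \<le> int n"
    using leaves_at_odd_distance critical4D(1)[OF crit wf_G] by metis
  \<comment> \<open>Tight at \<open>n = 8\<close>, where oddness gives \<open>k \<le> 3\<close>;
    from 12 on, \<open>2 * k \<le> n\<close> suffices.\<close>
  have "k + 5 \<le> int n" using k n n4 by presburger
  interpret s: crown n "\<lambda>j. p (j + i)" G L att by (rule shift_crown)
  let ?e = "{p (k + 2 + i), p (k + 3 + i)}"
  have "\<not> packing_colorable (verts G, edges G - {?e}) 3"
    by (rule s.not_packing_colorable_delete_edge[OF xy(1) _ xy(2)])
      (use xy k \<open>k + 5 \<le> int n\<close> in \<open>simp_all add: add.commute\<close>)
  moreover have "wf_graph (verts G, edges G - {?e})"
    using wf_G by (auto simp: wf_graph_iff_card)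
  ultimately have "G = (verts G, edges G - {?e})"
    by (intro critical4_subgraph_eq[OF crit]) auto
  then have "?e \<notin> edges G" by (metis Diff_iff edges_Pair insertI1)
  moreover have "?e = {p (k + 2 + i), p ((k + 2 + i) + 1)}" by (simp add: algebra_simps)
  ultimately show False using ring_edge[of "k + 2 + i"] by simp
qed

lemma critical4_cases:
  assumes crit: "critical4 G"
  shows "(\<exists>m\<ge>5. m mod 4 \<noteq> 0 \<and> graph_iso G (cycle_graph m)) \<or>
    graph_iso G net_graph \<or> graph_iso G C4_two_leaves"
proof -
  consider "n = 3" | "n = 4" | "n \<ge> 5" "\<not> 4 dvd n"
  proof -
    \<comment> \<open>A multiple of 4 that is at least 5 is at least 8.\<close>
    have "\<not> 4 dvd n" if "n \<ge> 5"
      using critical4_not_dvd[OF crit] that by presburger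
    moreover have "n = 3 \<or> n = 4 \<or> n \<ge> 5" using n_ge_3 by auto
    ultimately show thesis using that by blast
  qed
  then show ?thesis
  proof cases
    case 1
    then show ?thesis using critical4_triangle[OF crit] graph_iso_net_iff[OF wf_G] by blast
  next
    case 2
    then show ?thesis using critical4_square[OF crit] graph_iso_square2_iff[OF wf_G] by blast
  next
    case 3
    \<comment> \<open>The cycle alone is already an obstruction, which excludes any leaf.\<close>
    then have "G = ring_graph p"
      using ring_graph_not_packing_colorable
      by (intro critical4_subgraph_eq[OF crit wf_ring_graph ring_graph_subgraph]) auto
    then have "graph_iso G (cycle_graph n)"
      using graph_iso_cycle_graph_iff[OF n_ge_3 wf_G] cyclic_seq_axioms by blast
    then show ?thesis using 3 by (auto simp: dvd_eq_mod_eq_0)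
  qed
qed

end

theorem theorem3p4:
  fixes G :: "'a graph"
  assumes "G \<in> classC"
  shows "critical4 G \<longleftrightarrow>
    (\<exists>n\<ge>5. n mod 4 \<noteq> 0 \<and> graph_iso G (cycle_graph n)) \<or>
    graph_iso G net_graph \<or> graph_iso G C4_two_leaves"
proof -
  obtain n p L att where "crown n p G L att" using classC_crown[OF assms] .
  then interpret crown n p G L att .
  have "critical4 G" if m: "m \<ge> 5" "m mod 4 \<noteq> 0" and iso: "graph_iso G (cycle_graph m)" for m
  proof -
    have "m \<ge> 3" using m by simp
    then obtain q where q: "cyclic_seq m q" "G = ring_graph q"
      using graph_iso_cycle_graph_iff[OF _ wf_G] iso by blast
    then show ?thesis
      using cyclic_seq.critical4_ring_graph[OF q(1)] m by (simp add: dvd_eq_mod_eq_0)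
  qed
  moreover have "critical4 G" if "graph_iso G net_graph"
    using that critical4_net unfolding graph_iso_net_iff[OF wf_G] by metis
  moreover have "critical4 G" if "graph_iso G C4_two_leaves"
    using that critical4_square2 unfolding graph_iso_square2_iff[OF wf_G] by metis
  ultimately show ?thesis using critical4_cases by blast
qed

end
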